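(* Let $d\in\mathbb{N}$ and let $\varphi\colon(0,1]\to[0,d]$ be a function. Then there is a non-empty uniform set $F\subset\mathbb{R}^d$ with $(1-\theta)\dim^{\theta}_{\mathrm{L}}F=\varphi(\theta)$ for all $\theta\in(0,1]$ if and only if $\varphi$ is $d$-Lipschitz and $$\varphi(\theta)\leq\varphi(\lambda\theta)-\theta\varphi(\lambda)$$ for all $\lambda,\theta\in(0,1]$.
   Context: For a metric space $X$ (subsets of $\mathbb{R}^d$ carry the Euclidean metric), $B(x,r)$ denotes the closed ball in $X$, and for $E\subset X$: $N_r(E)$ denotes the least number of closed balls of radius $r$ required to cover $E$; $P_r(E)$ denotes the maximal cardinality of a subset of $E$ whose distinct points are at distance strictly larger than $4r$. For $0<\theta<1$ the lower spectrum is $$\dim^{\theta}_{\mathrm{L}}X=\sup\Bigl\{s\geq0:\exists C>0\ \forall\,0<r<1,\ \inf_{x\in X}N_r(B(x,r^\theta))\geq C\Bigl(\frac{r^\theta}{r}\Bigr)^s\Bigr\},$$ and for $\theta=1$ the expression $(1-\theta)\dim^{\theta}_{\mathrm{L}}F$ is defined to be $0$. Let $\Delta=\{(u,v)\in\mathbb{R}^2:v\leq u\}$ and, with $\log$ in base $2$, for $(u,v)\in\Delta$ let $$\underline{\beta}_X(u,v)=\log\inf_{x\in X}P_{2^{-u}}(B(x,2^{-v})),\qquad \overline{\beta}_X(u,v)=\log\sup_{x\in X}N_{2^{-u}}(B(x,2^{-v})).$$ For $\eta\colon\mathbb{R}\to\mathbb{R}$, $X$ is $\eta$-uniform if $\lim_{u\to\infty}u^{-1}\eta(u)=0$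 and $\overline{\beta}_X(u,v)\leq\underline{\beta}_X(u,v)+\eta(u)$ for all $(u,v)\in\Delta$. $X$ is uniform if it is $\eta$-uniform for some $\eta$. *)

theory Defs
  imports "HOL-Analysis.Analysis" "HOL-Library.Extended_Real"
begin

text \<open>A set \<open>X\<close> is regarded as a metric space with the distance of its ambient type: balls of
  \<open>X\<close> are intersected with \<open>X\<close> and have their centres in \<open>X\<close>. All quantities are defined
  in the extended numbers, so no finiteness is presupposed.\<close>

definition rel_cball :: "'a::metric_space set \<Rightarrow> 'a \<Rightarrow> real \<Rightarrow> 'a set" where
  "rel_cball X x r = cball x r \<inter> X"

definition covering_number :: "'a::metric_space set \<Rightarrow> real \<Rightarrow> 'a set \<Rightarrow> enat" where
  "covering_number X r E =
     (INF C \<in> {C. finite C \<and> C \<subseteq> X \<and> E \<subseteq> (\<Union>x\<in>C. rel_cball X x r)}. enat (card C))"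

definition packing_number :: "real \<Rightarrow> 'a::metric_space set \<Rightarrow> enat" where
  "packing_number r E =
     (SUP A \<in> {A. finite A \<and> A \<subseteq> E \<and> (\<forall>x\<in>A. \<forall>y\<in>A. x \<noteq> y \<longrightarrow> dist x y > 4 * r)}. enat (card A))"

definition lower_spectrum :: "real \<Rightarrow> 'a::metric_space set \<Rightarrow> ereal" where
  "lower_spectrum \<theta> X =
     (SUP s \<in> {s::real. s \<ge> 0 \<and> (\<exists>C>0. \<forall>r::real. 0 < r \<and> r < 1 \<longrightarrow>
         ereal_of_enat (INF x\<in>X. covering_number X r (rel_cball X x (r powr \<theta>)))
           \<ge> ereal (C * (r powr \<theta> / r) powr s))}. ereal s)"

definition scaled_lower_spectrum :: "real \<Rightarrow> 'a::metric_space set \<Rightarrow> ereal" where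
  "scaled_lower_spectrum \<theta> X =
     (if \<theta> = 1 then 0 else ereal (1 - \<theta>) * lower_spectrum \<theta> X)"

fun log2_enat :: "enat \<Rightarrow> ereal" where
  "log2_enat (enat n) = (if n = 0 then - \<infinity> else ereal (log 2 (real n)))"
| "log2_enat \<infinity> = \<infinity>"

definition lower_beta :: "'a::metric_space set \<Rightarrow> real \<Rightarrow> real \<Rightarrow> ereal" where
  "lower_beta X u v =
     log2_enat (INF x\<in>X. packing_number (2 powr (- u)) (rel_cball X x (2 powr (- v))))"

definition upper_beta :: "'a::metric_space set \<Rightarrow> real \<Rightarrow> real \<Rightarrow> ereal" where
  "upper_beta X u v =
     log2_enat (SUP x\<in>X. covering_number X (2 powr (- u)) (rel_cball X x (2 powr (- v))))"

definition eta_uniform :: "(real \<Rightarrow> real) \<Rightarrow> 'a::metric_space set \<Rightarrow> bool" where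
  "eta_uniform \<eta> X \<longleftrightarrow>
     ((\<lambda>u. inverse u * \<eta> u) \<longlongrightarrow> 0) at_top \<and>
     (\<forall>u v. v \<le> u \<longrightarrow> upper_beta X u v \<le> lower_beta X u v + ereal (\<eta> u))"

definition uniform_set :: "'a::metric_space set \<Rightarrow> bool" where
  "uniform_set X \<longleftrightarrow> (\<exists>\<eta>. eta_uniform \<eta> X)"

end

theory Submission
  imports Defs
begin

text \<open>
  Write \<open>lo u v\<close> for the logarithm of the least packing number of a ball of radius \<open>2 powr - v\<close> at
  scale \<open>2 powr - u\<close>, and \<open>hi u v\<close> for that of the greatest covering number. In a uniform set the two
  differ by \<open>o(u)\<close>, so \<open>(1 - \<theta>)\<close> times the lower spectrum at \<open>\<theta>\<close> is the lower limit of
  \<open>lo u (\<theta> * u) / u\<close> (\<open>le_scaled_lower_spectrum_iff\<close>).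

  Necessity. Refining a packing by packings of its balls shows that \<open>lo\<close> is superadditive along chains
  of scales, up to a change of the radius that uniformity absorbs. For the scales \<open>\<kappa> * \<theta> * u\<close>,
  \<open>\<theta> * u\<close>, \<open>u\<close> this gives \<open>\<phi> (\<kappa> * \<theta>) \<ge> \<phi> \<theta> + \<theta> * \<phi> \<kappa>\<close> in the limit, and in particular \<open>\<phi>\<close>
  is decreasing. Coverings are subadditive in the same sense, and a ball in dimension \<open>d\<close> is covered by
  a constant times \<open>2 powr (d * (u - v))\<close> balls, which gives the Lipschitz bound
  (\<open>scaled_lower_spectrum_necessary\<close>).

  Sufficiency. It is enough to find an increasing \<open>d\<close>-Lipschitz function \<open>f\<close> such that the lower limit of
  \<open>(f u - f (\<theta> * u)) / u\<close> is \<open>\<phi> \<theta>\<close>, together with a set for which \<open>lo u v\<close> and \<open>hi u v\<close> are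
  \<open>f u - f v\<close> up to a constant. For one scale \<open>U\<close> the function \<open>t \<mapsto> - U * \<phi> (t / U)\<close>, continued with slope
  \<open>d\<close> beyond \<open>U\<close>, has gap exactly \<open>\<phi> \<theta> * U\<close> at \<open>u = U\<close>, and the functional inequality says
  precisely that the gap is at least \<open>\<phi> \<theta> * u\<close> at all \<open>u \<le> U\<close> (\<open>profile_gap\<close>). Such lower
  bounds are preserved by infima. So \<open>f\<close> is the infimum of these functions over the scales
  \<open>U = fact k\<close>, each raised by a constant that makes it the relevant one near \<open>fact k\<close> but is
  negligible there (\<open>growth_gap\<close>, \<open>growth_gap_fact\<close>).

  The set is the \<open>d\<close>-fold power of a set of reals in \<open>[0, 1)\<close> whose binary digits are free at the
  places where the integer part of \<open>f / d\<close> increases, and vanish at the other places. All dyadic cubes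
  of one generation that meet it look the same inside, so up to bounded factors its counts are powers of
  two, with \<open>d\<close> times the number of free digits between the two scales
  in the exponent (\<open>upper_beta_cantor_set\<close>, \<open>lower_beta_cantor_set\<close>).
\<close>

section \<open>Finite packings and coverings\<close>

definition is_packing :: "real \<Rightarrow> 'a::metric_space set \<Rightarrow> 'a set \<Rightarrow> bool" where
  "is_packing r E A \<longleftrightarrow> finite A \<and> A \<subseteq> E \<and> (\<forall>x\<in>A. \<forall>y\<in>A. x \<noteq> y \<longrightarrow> dist x y > 4 * r)"

definition is_cover :: "'a::metric_space set \<Rightarrow> real \<Rightarrow> 'a set \<Rightarrow> 'a set \<Rightarrow> bool" where
  "is_cover X r E C \<longleftrightarrow> finite C \<and> C \<subseteq> X \<and> E \<subseteq> (\<Union>x\<in>C. rel_cball X x r)"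

lemma is_packing_singleton: "x \<in> E \<Longrightarrow> is_packing r E {x}"
  by (auto simp: is_packing_def)

text \<open>Infima and suprema of extended naturals are attained where they are finite, so that a bound on a
  covering or packing number is witnessed by an actual finite set.\<close>

lemma covering_number_le_iff:
  "covering_number X r E \<le> enat k \<longleftrightarrow> (\<exists>C. is_cover X r E C \<and> card C \<le> k)"
proof
  let ?S = "{C. finite C \<and> C \<subseteq> X \<and> E \<subseteq> (\<Union>x\<in>C. rel_cball X x r)}"
  assume le: "covering_number X r E \<le> enat k"
  have "?S \<noteq> {}"
  proof
    assume "?S = {}"
    then have "covering_number X r E = \<infinity>"
      unfolding covering_number_def by (simp only: image_empty Inf_empty top_enat_def)
    then show False using le by simp
  qed
  then have "covering_number X r E \<in> (\<lambda>C. enat (card C)) ` ?S"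
    unfolding covering_number_def by (metis (no_types, lifting) image_is_empty ex_in_conv wellorder_InfI)
  then show "\<exists>C. is_cover X r E C \<and> card C \<le> k"
    using le by (auto simp: is_cover_def)
next
  assume "\<exists>C. is_cover X r E C \<and> card C \<le> k"
  then obtain C where C: "is_cover X r E C" "card C \<le> k" by blast
  have "covering_number X r E \<le> enat (card C)"
    unfolding covering_number_def using C(1) by (intro INF_lower) (auto simp: is_cover_def)
  also have "\<dots> \<le> enat k" using C(2) by simp
  finally show "covering_number X r E \<le> enat k" .
qed

lemma packing_number_ge_iff:
  "enat k \<le> packing_number r E \<longleftrightarrow> (\<exists>A. is_packing r E A \<and> k \<le> card A)"
proof
  assume le: "enat k \<le> packing_number r E"
  show "\<exists>A. is_packing r E A \<and> k \<le> card A"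
  proof (cases k)
    case 0
    then show ?thesis by (intro exI[of _ "{}"]) (simp add: is_packing_def)
  next
    case (Suc j)
    show ?thesis
    proof (rule ccontr)
      assume no: "\<nexists>A. is_packing r E A \<and> k \<le> card A"
      have "packing_number r E \<le> enat j"
        unfolding packing_number_def
      proof (rule SUP_least)
        fix A assume "A \<in> {A. finite A \<and> A \<subseteq> E \<and> (\<forall>x\<in>A. \<forall>y\<in>A. x \<noteq> y \<longrightarrow> dist x y > 4 * r)}"
        then have "is_packing r E A" by (simp add: is_packing_def)
        then have "\<not> k \<le> card A" using no by blast
        then show "enat (card A) \<le> enat j" using Suc by simp
      qed
      then have "enat k \<le> enat j" using le by (rule order_trans[rotated])
      then show False using Suc by simp
    qed
  qed
next
  assume "\<exists>A. is_packing r E A \<and> k \<le> card A"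
  then obtain A where A: "is_packing r E A" "k \<le> card A" by blast
  have "enat k \<le> enat (card A)" using A(2) by simp
  also have "\<dots> \<le> packing_number r E"
    unfolding packing_number_def using A(1) by (intro SUP_upper) (auto simp: is_packing_def)
  finally show "enat k \<le> packing_number r E" .
qed

text \<open>A closed ball of radius \<open>r\<close> has diameter at most \<open>2r\<close>, hence contains at most one point of a
  \<open>4r\<close>-separated set.\<close>

lemma packing_le_cover:
  assumes "is_packing r E A" "is_cover X r E C"
  shows "card A \<le> card C"
proof -
  have "\<forall>a\<in>A. \<exists>c\<in>C. dist c a \<le> r"
  proof
    fix a assume "a \<in> A"
    then have "a \<in> (\<Union>c\<in>C. rel_cball X c r)"
      using assms \<open>a \<in> A\<close> unfolding is_packing_def is_cover_def by (meson subsetD)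
    then show "\<exists>c\<in>C. dist c a \<le> r" by (auto simp: rel_cball_def)
  qed
  then obtain g where g: "\<And>a. a \<in> A \<Longrightarrow> g a \<in> C \<and> dist (g a) a \<le> r" by metis
  have "inj_on g A"
  proof (rule inj_onI, rule ccontr)
    fix a b assume ab: "a \<in> A" "b \<in> A" "g a = g b" "a \<noteq> b"
    have "dist a b \<le> dist (g a) a + dist (g a) b" by (metis dist_commute dist_triangle)
    also have "\<dots> \<le> 2 * r" using g[OF ab(1)] g[OF ab(2)] ab(3) by simp
    finally have "dist a b \<le> 2 * r" .
    moreover have "dist a b > 4 * r" using assms(1) ab by (simp add: is_packing_def)
    moreover have "0 \<le> r" using g[OF ab(1)] zero_le_dist[of "g a" a] by linarith
    ultimately show False by linarith
  qed
  moreover have "g ` A \<subseteq> C" using g by blast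
  moreover have "finite C" using assms(2) by (simp add: is_cover_def)
  ultimately show ?thesis by (rule card_inj_on_le)
qed

text \<open>Coverings are obtained by sorting the points into finitely many classes of diameter at most
  \<open>r\<close> and taking a representative of each class.\<close>

lemma cover_by_classes:
  assumes "E \<subseteq> X" "finite Q" "q ` E \<subseteq> Q"
    and close: "\<And>y z. y \<in> E \<Longrightarrow> z \<in> E \<Longrightarrow> q y = q z \<Longrightarrow> dist y z \<le> r"
  shows "\<exists>C. is_cover X r E C \<and> card C \<le> card Q"
proof -
  define rep where "rep p = (SOME y. y \<in> E \<and> q y = p)" for p
  have rep: "rep (q y) \<in> E \<and> q (rep (q y)) = q y" if "y \<in> E" for y
    unfolding rep_def using that by (metis (mono_tags, lifting) someI)
  let ?C = "rep ` (q ` E)"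
  have fin: "finite (q ` E)" using assms(2,3) finite_subset by blast
  have "E \<subseteq> (\<Union>x\<in>?C. rel_cball X x r)"
  proof
    fix y assume y: "y \<in> E"
    then have "dist (rep (q y)) y \<le> r" using rep[OF y] close by blast
    then have "y \<in> rel_cball X (rep (q y)) r" using y assms(1) by (auto simp: rel_cball_def)
    then show "y \<in> (\<Union>x\<in>?C. rel_cball X x r)" using y by blast
  qed
  then have "is_cover X r E ?C" unfolding is_cover_def using fin rep assms(1) by auto
  moreover have "card ?C \<le> card Q"
    using card_image_le[OF fin, of rep] card_mono[OF assms(2,3)] by linarith
  ultimately show ?thesis by blast
qed

lemma ereal_of_enat_le_ereal_iff:
  assumes "0 \<le> y"
  shows "ereal_of_enat n \<le> ereal y \<longleftrightarrow> n \<le> enat (nat \<lfloor>y\<rfloor>)"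
  using assms by (cases n) (auto simp: le_nat_floor, linarith)

lemma ereal_le_ereal_of_enat_iff: "ereal y \<le> ereal_of_enat n \<longleftrightarrow> enat (nat \<lceil>y\<rceil>) \<le> n"
  by (cases n) (auto simp: nat_ceiling_le_eq)

lemma ereal_le_log2_enat_iff: "ereal s \<le> log2_enat n \<longleftrightarrow> ereal (2 powr s) \<le> ereal_of_enat n"
  by (cases n) (auto simp: le_log_iff)

lemma log2_enat_le_ereal_iff: "log2_enat n \<le> ereal s \<longleftrightarrow> ereal_of_enat n \<le> ereal (2 powr s)"
  by (cases n) (auto simp: log_le_iff)

lemma le_lower_beta_iff:
  "ereal s \<le> lower_beta X u v \<longleftrightarrow>
     (\<forall>x\<in>X. \<exists>A. is_packing (2 powr - u) (rel_cball X x (2 powr - v)) A \<and> 2 powr s \<le> card A)"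
  unfolding lower_beta_def ereal_le_log2_enat_iff ereal_le_ereal_of_enat_iff le_INF_iff
    packing_number_ge_iff nat_ceiling_le_eq ..

lemma upper_beta_le_iff:
  "upper_beta X u v \<le> ereal s \<longleftrightarrow>
     (\<forall>x\<in>X. \<exists>C. is_cover X (2 powr - u) (rel_cball X x (2 powr - v)) C \<and> card C \<le> 2 powr s)"
proof -
  have *: "card C \<le> nat \<lfloor>2 powr s\<rfloor> \<longleftrightarrow> real (card C) \<le> 2 powr s" for C :: "'a set"
    by (simp add: le_nat_iff le_floor_iff)
  show ?thesis
    unfolding upper_beta_def log2_enat_le_ereal_iff SUP_le_iff covering_number_le_iff *
      ereal_of_enat_le_ereal_iff[OF powr_ge_zero] ..
qed

lemma lower_beta_nonneg: "0 \<le> lower_beta X u v"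
proof -
  have "ereal 0 \<le> lower_beta X u v"
    unfolding le_lower_beta_iff
  proof
    fix x assume "x \<in> X"
    then have "is_packing (2 powr - u) (rel_cball X x (2 powr - v)) {x}"
      by (intro is_packing_singleton) (auto simp: rel_cball_def)
    then show "\<exists>A. is_packing (2 powr - u) (rel_cball X x (2 powr - v)) A \<and> 2 powr 0 \<le> real (card A)"
      by (intro exI[of _ "{x}"]) auto
  qed
  then show ?thesis by (simp add: zero_ereal_def)
qed

section \<open>Doubling spaces\<close>

text \<open>The doubling bound makes all logarithmic counts between comparable scales finite, so that they
  can be treated as real numbers.\<close>

locale doubling_set =
  fixes X :: "'a::metric_space set" and d K :: real
  assumes nonempty: "X \<noteq> {}"
    and doubling: "\<And>u v. v \<le> u \<Longrightarrow> upper_beta X u v \<le> ereal (d * (u - v) + K)"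
begin

definition lo :: "real \<Rightarrow> real \<Rightarrow> real" where
  "lo u v = real_of_ereal (lower_beta X u v)"

definition hi :: "real \<Rightarrow> real \<Rightarrow> real" where
  "hi u v = real_of_ereal (upper_beta X u v)"

lemma lower_beta_le_upper_beta: "lower_beta X u v \<le> upper_beta X u v"
proof -
  obtain x where x: "x \<in> X" using nonempty by blast
  have "packing_number r E \<le> covering_number X r E" for r and E :: "'a set"
  proof (rule ccontr)
    assume "\<not> packing_number r E \<le> covering_number X r E"
    then have lt: "covering_number X r E < packing_number r E" by simp
    then obtain k where k: "covering_number X r E = enat k" by (cases "covering_number X r E") auto
    then have "enat (Suc k) \<le> packing_number r E" using lt by (metis Suc_ile_eq)
    then obtain A C where "is_packing r E A" "Suc k \<le> card A" "is_cover X r E C" "card C \<le> k"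
      using k packing_number_ge_iff covering_number_le_iff by (metis order_refl)
    then show False using packing_le_cover by (metis Suc_n_not_le_n le_trans)
  qed
  then have "(INF x\<in>X. packing_number (2 powr (- u)) (rel_cball X x (2 powr (- v))))
      \<le> (SUP x\<in>X. covering_number X (2 powr (- u)) (rel_cball X x (2 powr (- v))))"
    by (meson INF_lower2 SUP_upper2 order_refl x)
  moreover have "log2_enat m \<le> log2_enat n" if "m \<le> n" for m n
    using that by (cases m; cases n) auto
  ultimately show ?thesis unfolding lower_beta_def upper_beta_def by blast
qed

lemma lower_beta_eq: "v \<le> u \<Longrightarrow> lower_beta X u v = ereal (lo u v)"
  and upper_beta_eq: "v \<le> u \<Longrightarrow> upper_beta X u v = ereal (hi u v)"
  using lower_beta_nonneg[of X u v] lower_beta_le_upper_beta[of u v] doubling[of v u]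
  unfolding lo_def hi_def
  by (cases "lower_beta X u v"; cases "upper_beta X u v"; auto)+

lemma lo_nonneg: "v \<le> u \<Longrightarrow> 0 \<le> lo u v"
  using lower_beta_nonneg[of X u v] by (simp add: lower_beta_eq)

lemma lo_le_hi: "v \<le> u \<Longrightarrow> lo u v \<le> hi u v"
  using lower_beta_le_upper_beta[of u v] by (simp add: lower_beta_eq upper_beta_eq)

lemma hi_le: "v \<le> u \<Longrightarrow> hi u v \<le> d * (u - v) + K"
  using doubling[of v u] by (simp add: upper_beta_eq)

lemma packing_lo:
  assumes "v \<le> u" "x \<in> X"
  obtains A where "is_packing (2 powr - u) (rel_cball X x (2 powr - v)) A" "2 powr lo u v \<le> card A"
  using le_lower_beta_iff[of "lo u v" X u v] assms by (auto simp: lower_beta_eq)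

lemma cover_hi:
  assumes "v \<le> u" "x \<in> X"
  obtains C where "is_cover X (2 powr - u) (rel_cball X x (2 powr - v)) C" "card C \<le> 2 powr hi u v"
  using upper_beta_le_iff[of X u v "hi u v"] assms by (auto simp: upper_beta_eq)

lemma le_loI:
  assumes "v \<le> u"
    and "\<And>x. x \<in> X \<Longrightarrow> \<exists>A. is_packing (2 powr - u) (rel_cball X x (2 powr - v)) A \<and> 2 powr s \<le> card A"
  shows "s \<le> lo u v"
  using assms le_lower_beta_iff[of s X u v] by (auto simp: lower_beta_eq)

lemma hi_leI:
  assumes "v \<le> u"
    and "\<And>x. x \<in> X \<Longrightarrow> \<exists>C. is_cover X (2 powr - u) (rel_cball X x (2 powr - v)) C \<and> card C \<le> 2 powr s"
  shows "hi u v \<le> s"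
  using assms upper_beta_le_iff[of X u v s] by (auto simp: upper_beta_eq)

text \<open>Refining a covering at scale \<open>w\<close> by coverings of its balls at scale \<open>u\<close>.\<close>

lemma hi_subadditive:
  assumes "v \<le> w" "w \<le> u"
  shows "hi u v \<le> hi w v + hi u w"
proof (rule hi_leI)
  show "v \<le> u" using assms by simp
  fix x assume "x \<in> X"
  then obtain C where C: "is_cover X (2 powr - w) (rel_cball X x (2 powr - v)) C"
      "card C \<le> 2 powr hi w v"
    using cover_hi[OF assms(1)] by blast
  have "\<forall>c\<in>C. \<exists>D. is_cover X (2 powr - u) (rel_cball X c (2 powr - w)) D \<and> card D \<le> 2 powr hi u w"
    using C(1) cover_hi[OF assms(2)] by (metis is_cover_def subsetD)
  then obtain D where D: "\<And>c. c \<in> C \<Longrightarrow> is_cover X (2 powr - u) (rel_cball X c (2 powr - w)) (D c)"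
      "\<And>c. c \<in> C \<Longrightarrow> card (D c) \<le> 2 powr hi u w"
    by metis
  have finC: "finite C" using C(1) by (simp add: is_cover_def)
  have "is_cover X (2 powr - u) (rel_cball X x (2 powr - v)) (\<Union>c\<in>C. D c)"
    unfolding is_cover_def
  proof (intro conjI)
    show "finite (\<Union>c\<in>C. D c)" "(\<Union>c\<in>C. D c) \<subseteq> X"
      using finC D(1) by (auto simp: is_cover_def)
    show "rel_cball X x (2 powr - v) \<subseteq> (\<Union>y\<in>\<Union>c\<in>C. D c. rel_cball X y (2 powr - u))"
    proof
      fix y assume "y \<in> rel_cball X x (2 powr - v)"
      then obtain c where c: "c \<in> C" "y \<in> rel_cball X c (2 powr - w)"
        using C(1) by (auto simp: is_cover_def)
      then have "y \<in> (\<Union>z\<in>D c. rel_cball X z (2 powr - u))"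
        using D(1)[OF c(1)] by (auto simp: is_cover_def)
      then show "y \<in> (\<Union>y\<in>\<Union>c\<in>C. D c. rel_cball X y (2 powr - u))" using c(1) by blast
    qed
  qed
  moreover have "real (card (\<Union>c\<in>C. D c)) \<le> 2 powr (hi w v + hi u w)"
  proof -
    have "real (card (\<Union>c\<in>C. D c)) \<le> (\<Sum>c\<in>C. real (card (D c)))"
      using card_UN_le[OF finC, of D] by (metis of_nat_le_iff of_nat_sum)
    also have "\<dots> \<le> real (card C) * 2 powr hi u w"
      using sum_bounded_above[of C "\<lambda>c. real (card (D c))", OF D(2)] by simp
    also have "\<dots> \<le> 2 powr hi w v * 2 powr hi u w"
      using C(2) by (intro mult_right_mono) auto
    finally show ?thesis by (simp add: powr_add)
  qed
  ultimately show "\<exists>C. is_cover X (2 powr - u) (rel_cball X x (2 powr - v)) C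
      \<and> card C \<le> 2 powr (hi w v + hi u w)" by blast
qed

text \<open>Packings are refined in the same way. The margins of one unit keep the refined points inside
  the original ball and keep points refining different parents separated.\<close>

lemma lo_superadditive:
  assumes "w + 1 \<le> v" "v + 1 \<le> u"
  shows "lo v (w + 1) + lo u v \<le> lo u w"
proof (rule le_loI)
  show "w \<le> u" using assms by simp
  fix x assume "x \<in> X"
  then obtain A where A: "is_packing (2 powr - v) (rel_cball X x (2 powr - (w + 1))) A"
      "2 powr lo v (w + 1) \<le> card A"
    using packing_lo[OF assms(1)] by blast
  have vu: "v \<le> u" using assms by simp
  have "\<forall>a\<in>A. \<exists>B. is_packing (2 powr - u) (rel_cball X a (2 powr - v)) B \<and> 2 powr lo u v \<le> card B"
  proof
    fix a assume "a \<in> A"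
    then have "a \<in> X" using A(1) by (auto simp: is_packing_def rel_cball_def)
    then show "\<exists>B. is_packing (2 powr - u) (rel_cball X a (2 powr - v)) B \<and> 2 powr lo u v \<le> card B"
      using packing_lo[OF vu] by blast
  qed
  then obtain B where B: "\<And>a. a \<in> A \<Longrightarrow> is_packing (2 powr - u) (rel_cball X a (2 powr - v)) (B a)"
      "\<And>a. a \<in> A \<Longrightarrow> 2 powr lo u v \<le> card (B a)"
    by metis
  have finA: "finite A" using A(1) by (simp add: is_packing_def)
  have finB: "finite (B a)" if "a \<in> A" for a using B(1)[OF that] by (simp add: is_packing_def)
  have near: "dist a y \<le> 2 powr - v" "y \<in> X" if "a \<in> A" "y \<in> B a" for a y
    using B(1)[OF that(1)] that(2) by (auto simp: is_packing_def rel_cball_def)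
  have uv: "4 * 2 powr - u \<le> 2 * 2 powr - v"
  proof -
    have "2 powr - u \<le> 2 powr (- v - 1)" using assms by (intro powr_mono) auto
    then show ?thesis by (simp add: powr_diff)
  qed
  have wv: "2 powr - (w + 1) + 2 powr - v \<le> 2 powr - w"
  proof -
    have "2 powr - v \<le> 2 powr - (w + 1)" using assms by (intro powr_mono) auto
    then have "2 powr - (w + 1) + 2 powr - v \<le> 2 * 2 powr - (w + 1)" by simp
    also have "\<dots> = 2 powr - w" by (simp add: powr_diff)
    finally show ?thesis .
  qed
  have sep: "dist y z > 4 * 2 powr - u" if "a \<in> A" "b \<in> A" "a \<noteq> b" "y \<in> B a" "z \<in> B b" for a b y z
  proof -
    have "dist a b > 4 * 2 powr - v" using A(1) that by (simp add: is_packing_def)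
    moreover have "dist a b \<le> dist a y + dist y b" "dist y b \<le> dist y z + dist b z"
      using dist_triangle[of a b y] dist_triangle[of y b z] by (simp_all add: dist_commute)
    ultimately show ?thesis using near[OF that(1,4)] near[OF that(2,5)] uv by linarith
  qed
  have "is_packing (2 powr - u) (rel_cball X x (2 powr - w)) (\<Union>a\<in>A. B a)"
    unfolding is_packing_def
  proof (intro conjI ballI impI)
    show "finite (\<Union>a\<in>A. B a)" using finA finB by blast
    show "(\<Union>a\<in>A. B a) \<subseteq> rel_cball X x (2 powr - w)"
    proof
      fix y assume "y \<in> (\<Union>a\<in>A. B a)"
      then obtain a where a: "a \<in> A" "y \<in> B a" by blast
      have "dist x a \<le> 2 powr - (w + 1)" using A(1) a by (auto simp: is_packing_def rel_cball_def)
      then have "dist x y \<le> 2 powr - w"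
        using near[OF a] dist_triangle[of x y a] wv by linarith
      then show "y \<in> rel_cball X x (2 powr - w)" using near[OF a] by (simp add: rel_cball_def)
    qed
    fix y z assume yz: "y \<in> (\<Union>a\<in>A. B a)" "z \<in> (\<Union>a\<in>A. B a)" "y \<noteq> z"
    then obtain a b where ab: "a \<in> A" "b \<in> A" "y \<in> B a" "z \<in> B b" by blast
    show "4 * 2 powr - u < dist y z"
    proof (cases "a = b")
      case True
      then show ?thesis using B(1)[OF ab(1)] ab yz(3) by (simp add: is_packing_def)
    next
      case False
      then show ?thesis using sep ab by blast
    qed
  qed
  moreover have "2 powr (lo v (w + 1) + lo u v) \<le> real (card (\<Union>a\<in>A. B a))"
  proof -
    have disj: "B a \<inter> B b = {}" if "a \<in> A" "b \<in> A" "a \<noteq> b" for a b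
    proof (rule ccontr)
      assume "B a \<inter> B b \<noteq> {}"
      then obtain y where "y \<in> B a" "y \<in> B b" by blast
      then have "dist y y > 4 * 2 powr - u" using sep that by blast
      then show False using powr_ge_zero[of 2 "- u"] by (simp add: not_less)
    qed
    have "2 powr (lo v (w + 1) + lo u v) \<le> real (card A) * 2 powr lo u v"
      using A(2) by (simp add: powr_add mult_right_mono)
    also have "\<dots> \<le> (\<Sum>a\<in>A. real (card (B a)))"
      using sum_bounded_below[of A _ "\<lambda>a. real (card (B a))", OF B(2)] by simp
    also have "\<dots> = real (card (\<Union>a\<in>A. B a))"
      using card_UN_disjoint[of A B] finA finB disj by simp
    finally show ?thesis .
  qed
  ultimately show "\<exists>A. is_packing (2 powr - u) (rel_cball X x (2 powr - w)) A
      \<and> 2 powr (lo v (w + 1) + lo u v) \<le> card A" by blast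
qed

end


section \<open>The lower spectrum of a uniform set\<close>

context doubling_set
begin

text \<open>The lower spectrum uses the least covering number of a ball. Its logarithm lies between \<open>lo\<close>
  and \<open>hi\<close>, and these two agree up to a sublinear error for uniform sets.\<close>

definition inner_cover :: "real \<Rightarrow> real \<Rightarrow> enat" where
  "inner_cover u v = (INF x\<in>X. covering_number X (2 powr - u) (rel_cball X x (2 powr - v)))"

lemma le_inner_cover:
  assumes "v \<le> u" "s \<le> lo u v"
  shows "ereal (2 powr s) \<le> ereal_of_enat (inner_cover u v)"
  unfolding inner_cover_def ereal_le_ereal_of_enat_iff le_INF_iff
proof (intro ballI, rule ccontr)
  let ?k = "nat \<lceil>2 powr s\<rceil>"
  fix x assume x: "x \<in> X"
    and "\<not> enat ?k \<le> covering_number X (2 powr - u) (rel_cball X x (2 powr - v))"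
  then have lt: "covering_number X (2 powr - u) (rel_cball X x (2 powr - v)) < enat ?k" by simp
  then obtain j where j: "covering_number X (2 powr - u) (rel_cball X x (2 powr - v)) = enat j" "j < ?k"
    by (cases "covering_number X (2 powr - u) (rel_cball X x (2 powr - v))") auto
  then obtain C where C: "is_cover X (2 powr - u) (rel_cball X x (2 powr - v)) C" "card C \<le> j"
    using covering_number_le_iff by (metis order_refl)
  obtain A where A: "is_packing (2 powr - u) (rel_cball X x (2 powr - v)) A" "2 powr lo u v \<le> card A"
    using packing_lo[OF assms(1) x] .
  have "2 powr s \<le> 2 powr lo u v" using assms(2) by simp
  then have "2 powr s \<le> card A" using A(2) by linarith
  then have "?k \<le> card A" by (simp add: nat_ceiling_le_eq)
  then show False using packing_le_cover[OF A(1) C(1)] C(2) j(2) by linarith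
qed

lemma inner_cover_le:
  assumes "v \<le> u" "ereal (2 powr s) \<le> ereal_of_enat (inner_cover u v)"
  shows "s \<le> hi u v"
proof -
  obtain x where x: "x \<in> X" using nonempty by blast
  then obtain C where C: "is_cover X (2 powr - u) (rel_cball X x (2 powr - v)) C" "card C \<le> 2 powr hi u v"
    using cover_hi[OF assms(1)] by blast
  have "inner_cover u v \<le> covering_number X (2 powr - u) (rel_cball X x (2 powr - v))"
    unfolding inner_cover_def using x by (rule INF_lower)
  also have "\<dots> \<le> enat (card C)" using C(1) covering_number_le_iff by blast
  finally have "ereal_of_enat (inner_cover u v) \<le> ereal_of_enat (enat (card C))"
    by (simp only: ereal_of_enat_le_iff)
  with assms(2) have "ereal (2 powr s) \<le> ereal_of_enat (enat (card C))" by (rule order_trans)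
  then have "2 powr s \<le> card C" by simp
  then have "2 powr s \<le> 2 powr hi u v" using C(2) by linarith
  then show ?thesis by simp
qed

text \<open>Substituting \<open>r = 2 powr - u\<close> and \<open>C = 2 powr a\<close> in the definition of the lower spectrum.\<close>

lemma admissible_exponent_iff:
  "(\<exists>C>0. \<forall>r::real. 0 < r \<and> r < 1 \<longrightarrow>
         ereal_of_enat (INF x\<in>X. covering_number X r (rel_cball X x (r powr \<theta>)))
           \<ge> ereal (C * (r powr \<theta> / r) powr s)) \<longleftrightarrow>
   (\<exists>a. \<forall>u>0. ereal (2 powr (a + (1 - \<theta>) * u * s)) \<le> ereal_of_enat (inner_cover u (\<theta> * u)))"
  (is "(\<exists>C>0. \<forall>r. ?P C r) \<longleftrightarrow> (\<exists>a. \<forall>u>0. ?Q a u)")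
proof -
  have PQ: "?P (2 powr a) (2 powr - u) \<longleftrightarrow> ?Q a u" if "u > 0" for a u :: real
  proof -
    have "2 powr - u < (1::real)" using that powr_less_cancel_iff[of "2::real" "- u" 0] by simp
    moreover have "(2 powr - u) powr \<theta> = (2::real) powr - (\<theta> * u)" by (simp add: powr_powr mult.commute)
    moreover have "2 powr a * (2 powr - (\<theta> * u) / 2 powr - u) powr s = (2::real) powr (a + (1 - \<theta>) * u * s)"
      by (simp add: powr_diff[symmetric] powr_powr powr_add[symmetric] algebra_simps)
    ultimately show ?thesis by (simp add: inner_cover_def)
  qed
  show ?thesis
  proof
    assume "\<exists>C>0. \<forall>r. ?P C r"
    then obtain C where C: "C > 0" "\<forall>r. ?P C r" by blast
    then have "\<forall>r. ?P (2 powr (log 2 C)) r" by simp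
    then have "\<forall>u>0. ?Q (log 2 C) u" using PQ by blast
    then show "\<exists>a. \<forall>u>0. ?Q a u" by blast
  next
    assume "\<exists>a. \<forall>u>0. ?Q a u"
    then obtain a where a: "\<forall>u>0. ?Q a u" by blast
    have "?P (2 powr a) r" for r
    proof (cases "0 < r \<and> r < 1")
      case True
      then have "2 powr - (- log 2 r) = r" "- log 2 r > 0" by simp_all
      then show ?thesis using PQ[of "- log 2 r" a] a by metis
    qed blast
    then show "\<exists>C>0. \<forall>r. ?P C r" by (metis powr_gt_zero zero_neq_numeral)
  qed
qed

text \<open>The whole ball of radius \<open>r\<close> is covered by itself, so all its \<open>4r\<close>-separated subsets are
  singletons or empty.\<close>

lemma lo_same_scale: "lo u u = 0"
proof -
  obtain x where x: "x \<in> X" using nonempty by blast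
  obtain A where A: "is_packing (2 powr - u) (rel_cball X x (2 powr - u)) A" "2 powr lo u u \<le> card A"
    using packing_lo[OF order_refl x] .
  have "is_cover X (2 powr - u) (rel_cball X x (2 powr - u)) {x}"
    using x by (simp add: is_cover_def)
  then have "card A \<le> 1" using packing_le_cover[OF A(1)] by fastforce
  then have "2 powr lo u u \<le> 2 powr (0::real)" using A(2) by simp
  then have "lo u u \<le> 0" by (subst (asm) powr_le_cancel_iff) auto
  then show ?thesis using lo_nonneg[of u u] by simp
qed

text \<open>The real numbers \<open>c\<close> below the lower limit of \<open>lo u (\<theta> * u) / u\<close>; taking them one at a time
  avoids extended-valued lower limits.\<close>

definition growth_at_least :: "real \<Rightarrow> real \<Rightarrow> bool" where
  "growth_at_least \<theta> c \<longleftrightarrow> (\<forall>\<epsilon>>0. \<forall>\<^sub>F u in at_top. (c - \<epsilon>) * u \<le> lo u (\<theta> * u))"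

end

lemma eventually_const_le_linear:
  fixes a \<epsilon> :: real
  assumes "\<epsilon> > 0"
  shows "\<forall>\<^sub>F u in at_top. a \<le> \<epsilon> * u"
  using eventually_ge_at_top[of "a / \<epsilon>"] by eventually_elim (use assms in \<open>simp add: field_simps\<close>)

locale uniform_doubling_set = doubling_set X d K for X :: "'a::metric_space set" and d K +
  fixes \<eta> :: "real \<Rightarrow> real"
  assumes error_limit: "((\<lambda>u. inverse u * \<eta> u) \<longlongrightarrow> 0) at_top"
    and hi_le_lo: "\<And>u v. v \<le> u \<Longrightarrow> hi u v \<le> lo u v + \<eta> u"

lemma (in doubling_set) uniform_doubling_set_iff:
  "eta_uniform \<eta> X \<longleftrightarrow> uniform_doubling_set X d K \<eta>"
proof -
  have "upper_beta X u v \<le> lower_beta X u v + ereal (\<eta> u) \<longleftrightarrow> hi u v \<le> lo u v + \<eta> u" if "v \<le> u" for u v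
    using that by (simp add: lower_beta_eq upper_beta_eq)
  then show ?thesis
    unfolding eta_uniform_def uniform_doubling_set_def uniform_doubling_set_axioms_def
    using doubling_set_axioms by auto
qed

context uniform_doubling_set
begin

lemma error_le:
  assumes "\<epsilon> > 0"
  shows "\<forall>\<^sub>F u in at_top. \<bar>\<eta> u\<bar> \<le> \<epsilon> * u"
proof -
  have "\<forall>\<^sub>F u in at_top. \<bar>inverse u * \<eta> u\<bar> < \<epsilon>"
    using tendstoD[OF error_limit assms] by (simp add: dist_real_def)
  then show ?thesis using eventually_gt_at_top[of "0::real"]
  proof eventually_elim
    case (elim u)
    then have "\<bar>\<eta> u\<bar> / u < \<epsilon>" by (simp add: abs_mult field_simps)
    then show ?case using elim(2) by (simp add: field_simps)
  qed
qed

text \<open>Uniformity makes the infimum of covering numbers in the definition of the lower spectrum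
  interchangeable with the packing numbers, up to the sublinear error.\<close>

lemma le_scaled_lower_spectrum_iff:
  assumes \<theta>: "\<theta> \<in> {0<..1}"
  shows "ereal c \<le> scaled_lower_spectrum \<theta> X \<longleftrightarrow> growth_at_least \<theta> c"
proof (cases "\<theta> = 1")
  case True
  have "growth_at_least 1 c \<longleftrightarrow> c \<le> 0"
  proof
    assume g: "growth_at_least 1 c"
    show "c \<le> 0"
    proof (rule ccontr)
      assume "\<not> c \<le> 0"
      then have "c / 2 > 0" by simp
      then have "\<forall>\<^sub>F u in at_top. (c - c / 2) * u \<le> 0"
        using g by (simp only: growth_at_least_def lo_same_scale mult_1)
      then have "\<forall>\<^sub>F u::real in at_top. False"
        using eventually_gt_at_top[of "0::real"]
        by eventually_elim (use \<open>c / 2 > 0\<close> in \<open>simp add: mult_le_0_iff\<close>)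
      then show False by simp
    qed
  next
    assume "c \<le> 0"
    show "growth_at_least 1 c"
      unfolding growth_at_least_def
    proof (intro allI impI)
      fix \<epsilon> :: real assume "\<epsilon> > 0"
      show "\<forall>\<^sub>F u in at_top. (c - \<epsilon>) * u \<le> lo u (1 * u)"
        using eventually_gt_at_top[of "0::real"]
        by eventually_elim (use \<open>c \<le> 0\<close> \<open>\<epsilon> > 0\<close> in \<open>simp add: lo_same_scale mult_le_0_iff\<close>)
    qed
  qed
  then show ?thesis using True by (simp add: scaled_lower_spectrum_def zero_ereal_def)
next
  case False
  then have th: "0 < \<theta>" "\<theta> < 1" using \<theta> by auto
  have vu: "\<theta> * u \<le> u" if "u > 0" for u using th that by simp
  define S where "S = {s::real. s \<ge> 0 \<and>
     (\<exists>a. \<forall>u>0. ereal (2 powr (a + (1 - \<theta>) * u * s)) \<le> ereal_of_enat (inner_cover u (\<theta> * u)))}"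
  have spec: "scaled_lower_spectrum \<theta> X = ereal (1 - \<theta>) * (SUP s\<in>S. ereal s)"
    unfolding scaled_lower_spectrum_def lower_spectrum_def admissible_exponent_iff S_def
    using False by simp
  show ?thesis
  proof
    assume le: "ereal c \<le> scaled_lower_spectrum \<theta> X"
    show "growth_at_least \<theta> c"
      unfolding growth_at_least_def
    proof (intro allI impI)
      fix \<epsilon> :: real assume \<epsilon>: "\<epsilon> > 0"
      have "ereal ((c - \<epsilon> / 2) / (1 - \<theta>)) < (SUP s\<in>S. ereal s)"
        using le[unfolded spec] th \<epsilon> by (cases "SUP s\<in>S. ereal s") (auto simp: field_simps)
      then obtain s where s: "s \<in> S" "(c - \<epsilon> / 2) / (1 - \<theta>) < s"
        by (auto simp: less_SUP_iff)
      then obtain a where a: "\<And>u. u > 0 \<Longrightarrow>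
          ereal (2 powr (a + (1 - \<theta>) * u * s)) \<le> ereal_of_enat (inner_cover u (\<theta> * u))"
        by (auto simp: S_def)
      have s': "c - \<epsilon> / 2 \<le> (1 - \<theta>) * s" using s(2) th by (simp add: field_simps)
      have e4: "\<epsilon> / 4 > 0" using \<epsilon> by simp
      show "\<forall>\<^sub>F u in at_top. (c - \<epsilon>) * u \<le> lo u (\<theta> * u)"
        using error_le[OF e4] eventually_const_le_linear[OF e4, of "- a"] eventually_gt_at_top[of "0::real"]
      proof eventually_elim
        case (elim u)
        have "a + (1 - \<theta>) * u * s \<le> hi u (\<theta> * u)" using inner_cover_le vu a elim(3) by blast
        moreover have "hi u (\<theta> * u) \<le> lo u (\<theta> * u) + \<eta> u" using hi_le_lo vu elim(3) by blast
        moreover have "(c - \<epsilon> / 2) * u \<le> (1 - \<theta>) * s * u"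
          using s' elim(3) by (intro mult_right_mono) auto
        ultimately show ?case using elim(1,2) by (simp add: algebra_simps)
      qed
    qed
  next
    assume g: "growth_at_least \<theta> c"
    have "(0::real) \<in> S"
      unfolding S_def
      by (auto intro!: exI[of _ 0] le_inner_cover[where s = 0, simplified] lo_nonneg vu)
    then have nonneg: "0 \<le> (SUP s\<in>S. ereal s)" by (rule SUP_upper2) simp
    show "ereal c \<le> scaled_lower_spectrum \<theta> X"
    proof (rule ereal_le_epsilon2)
      fix \<epsilon> :: real assume \<epsilon>: "\<epsilon> > 0"
      have "ereal (c - \<epsilon>) \<le> scaled_lower_spectrum \<theta> X"
      proof (cases "c - \<epsilon> \<ge> 0")
        case False
        then have "ereal (c - \<epsilon>) \<le> 0" by simp
        also have "0 \<le> scaled_lower_spectrum \<theta> X" unfolding spec using nonneg th by simp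
        finally show ?thesis .
      next
        case True
        define s where "s = (c - \<epsilon>) / (1 - \<theta>)"
        have cs: "c - \<epsilon> = (1 - \<theta>) * s" using th by (simp add: s_def)
        obtain u0 where u0: "\<And>u. u \<ge> u0 \<Longrightarrow> (c - \<epsilon>) * u \<le> lo u (\<theta> * u)"
          using g \<epsilon> unfolding growth_at_least_def eventually_at_top_linorder by blast
        \<comment> \<open>Below \<open>u0\<close> the trivial bound \<open>lo \<ge> 0\<close> suffices, because of the choice of the constant.\<close>
        define a where "a = - (c - \<epsilon>) * \<bar>u0\<bar>"
        have a: "a \<le> 0" unfolding a_def using True by (intro mult_nonpos_nonneg) auto
        have "s \<in> S"
          unfolding S_def
        proof (intro CollectI conjI exI[of _ a] allI impI)
          show "0 \<le> s" using True th by (simp add: s_def)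
          fix u :: real assume u: "u > 0"
          have "a + (1 - \<theta>) * u * s = a + (c - \<epsilon>) * u" by (simp add: cs)
          also have "\<dots> \<le> lo u (\<theta> * u)"
          proof (cases "u \<ge> u0")
            case True
            then show ?thesis using u0[of u] a by linarith
          next
            case False
            then have "(c - \<epsilon>) * u \<le> (c - \<epsilon>) * \<bar>u0\<bar>" using True by (intro mult_left_mono) auto
            then have "a + (c - \<epsilon>) * u \<le> 0" by (simp add: a_def algebra_simps)
            then show ?thesis using lo_nonneg[OF vu[OF u]] by linarith
          qed
          finally show "ereal (2 powr (a + (1 - \<theta>) * u * s)) \<le> ereal_of_enat (inner_cover u (\<theta> * u))"
            using le_inner_cover vu[OF u] by blast
        qed
        then have "ereal s \<le> (SUP s\<in>S. ereal s)" by (rule SUP_upper)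
        then have "ereal (1 - \<theta>) * ereal s \<le> scaled_lower_spectrum \<theta> X"
          unfolding spec using th by (intro ereal_mult_left_mono) auto
        then show ?thesis by (simp add: cs)
      qed
      then have "ereal (c - \<epsilon>) + ereal \<epsilon> \<le> scaled_lower_spectrum \<theta> X + ereal \<epsilon>"
        by (rule add_right_mono)
      then show "ereal c \<le> scaled_lower_spectrum \<theta> X + ereal \<epsilon>" by simp
    qed
  qed
qed

lemma scaled_lower_spectrum_eqI:
  assumes "\<theta> \<in> {0<..1}" "growth_at_least \<theta> p" "\<And>c. growth_at_least \<theta> c \<Longrightarrow> c \<le> p"
  shows "scaled_lower_spectrum \<theta> X = ereal p"
proof (rule antisym)
  show "ereal p \<le> scaled_lower_spectrum \<theta> X"
    using assms(1,2) le_scaled_lower_spectrum_iff by blast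
  show "scaled_lower_spectrum \<theta> X \<le> ereal p"
  proof (rule ccontr)
    assume "\<not> scaled_lower_spectrum \<theta> X \<le> ereal p"
    then obtain z where "ereal p < ereal z" "ereal z < scaled_lower_spectrum \<theta> X"
      using ereal_dense2[of "ereal p" "scaled_lower_spectrum \<theta> X"] by (auto simp: not_le)
    then show False using le_scaled_lower_spectrum_iff[OF assms(1), of z] assms(3)[of z]
      by (simp add: less_imp_le)
  qed
qed

text \<open>In a uniform set the large ball may be shrunk by a bounded factor: the loss is bounded for
  covering numbers by doubling, and uniformity transfers this to packing numbers. This pays for the
  margin in the superadditivity of \<open>lo\<close>.\<close>

lemma lo_shift:
  assumes "w + 1 \<le> v"
  shows "lo v w \<le> lo v (w + 1) + \<eta> v + d + K"
proof -
  have "lo v w \<le> hi v w" using lo_le_hi assms by simp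
  also have "\<dots> \<le> hi (w + 1) w + hi v (w + 1)" using hi_subadditive assms by simp
  also have "hi (w + 1) w \<le> d + K" using hi_le[of w "w + 1"] by simp
  also have "hi v (w + 1) \<le> lo v (w + 1) + \<eta> v" using hi_le_lo assms by simp
  finally show ?thesis by simp
qed

text \<open>Going from scale \<open>\<kappa> * \<theta> * u\<close> to \<open>u\<close> by way of \<open>\<theta> * u\<close>: the first step is the growth over the
  ratio \<open>\<kappa>\<close> at \<open>\<theta> * u\<close> and therefore carries the weight \<open>\<theta>\<close>.\<close>

lemma growth_superadditive:
  assumes \<kappa>: "0 < \<kappa>" "\<kappa> < 1" and \<theta>: "0 < \<theta>" "\<theta> < 1"
    and a: "growth_at_least \<kappa> a" and b: "growth_at_least \<theta> b"
  shows "growth_at_least (\<kappa> * \<theta>) (b + \<theta> * a)"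
  unfolding growth_at_least_def
proof (intro allI impI)
  fix \<epsilon> :: real assume \<epsilon>: "\<epsilon> > 0"
  then have e4: "\<epsilon> / 4 > 0" by simp
  have lim: "filterlim (\<lambda>u. \<theta> * u) at_top at_top"
    using \<theta>(1) by (intro filterlim_tendsto_pos_mult_at_top[OF tendsto_const _ filterlim_ident])
  have A: "\<forall>\<^sub>F u in at_top. (a - \<epsilon> / 4) * u \<le> lo u (\<kappa> * u)"
    using a e4 unfolding growth_at_least_def by blast
  have B: "\<forall>\<^sub>F u in at_top. (b - \<epsilon> / 4) * u \<le> lo u (\<theta> * u)"
    using b e4 unfolding growth_at_least_def by blast
  have t1: "\<theta> * (1 - \<kappa>) > 0" "1 - \<theta> > 0" using \<theta> \<kappa> by simp_all
  \<comment> \<open>The bounds with \<open>t1\<close> make \<open>u\<close> so large that the three scales are a unit apart.\<close>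
  show "\<forall>\<^sub>F u in at_top. (b + \<theta> * a - \<epsilon>) * u \<le> lo u (\<kappa> * \<theta> * u)"
    using B eventually_compose_filterlim[OF A lim] eventually_compose_filterlim[OF error_le[OF e4] lim]
      eventually_const_le_linear[OF e4, of "d + K"] eventually_const_le_linear[OF t1(1), of 1] eventually_const_le_linear[OF t1(2), of 1]
      eventually_gt_at_top[of "0::real"]
  proof eventually_elim
    case (elim u)
    let ?w = "\<kappa> * (\<theta> * u)"
    have w: "?w + 1 \<le> \<theta> * u" using elim(5) by (simp add: algebra_simps)
    have "\<theta> * u + 1 \<le> u" using elim(6) by (simp add: algebra_simps)
    then have "lo (\<theta> * u) (?w + 1) + lo u (\<theta> * u) \<le> lo u ?w"
      using lo_superadditive w by blast
    moreover have "lo (\<theta> * u) ?w \<le> lo (\<theta> * u) (?w + 1) + \<eta> (\<theta> * u) + d + K"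
      using lo_shift[OF w] .
    moreover have "\<epsilon> / 4 * (\<theta> * u) \<le> \<epsilon> / 4 * u"
      using elim(7) \<theta> \<epsilon> by (intro mult_left_mono) auto
    ultimately show ?case using elim(1-4) by (simp add: algebra_simps)
  qed
qed

text \<open>By subadditivity of \<open>hi\<close>, inserting the scale \<open>\<theta> * u\<close> between \<open>\<kappa> * u\<close> and \<open>u\<close> costs no more than
  the doubling bound between the first two.\<close>

lemma growth_lipschitz:
  assumes "0 < \<kappa>" "\<kappa> \<le> \<theta>" "\<theta> \<le> 1" and a: "growth_at_least \<kappa> a"
  shows "growth_at_least \<theta> (a - d * (\<theta> - \<kappa>))"
  unfolding growth_at_least_def
proof (intro allI impI)
  fix \<epsilon> :: real assume \<epsilon>: "\<epsilon> > 0"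
  then have e4: "\<epsilon> / 4 > 0" by simp
  have A: "\<forall>\<^sub>F u in at_top. (a - \<epsilon> / 4) * u \<le> lo u (\<kappa> * u)"
    using a e4 unfolding growth_at_least_def by blast
  show "\<forall>\<^sub>F u in at_top. (a - d * (\<theta> - \<kappa>) - \<epsilon>) * u \<le> lo u (\<theta> * u)"
    using A error_le[OF e4] eventually_const_le_linear[OF e4, of K] eventually_gt_at_top[of "0::real"]
  proof eventually_elim
    case (elim u)
    have le: "\<kappa> * u \<le> \<theta> * u" "\<theta> * u \<le> u" "\<kappa> * u \<le> u" using elim(4) assms by auto
    have "lo u (\<kappa> * u) \<le> hi u (\<kappa> * u)" using lo_le_hi le by blast
    also have "\<dots> \<le> hi (\<theta> * u) (\<kappa> * u) + hi u (\<theta> * u)" using hi_subadditive le by blast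
    also have "hi u (\<theta> * u) \<le> lo u (\<theta> * u) + \<eta> u" using hi_le_lo le by blast
    also have "hi (\<theta> * u) (\<kappa> * u) \<le> d * (\<theta> * u - \<kappa> * u) + K" using hi_le le by blast
    finally have "lo u (\<kappa> * u) \<le> d * (\<theta> * u - \<kappa> * u) + K + (lo u (\<theta> * u) + \<eta> u)" by simp
    moreover have "\<epsilon> * u \<ge> 0" using \<epsilon> elim(4) by simp
    ultimately show ?case using elim(1-3) by (simp add: algebra_simps)
  qed
qed

theorem scaled_lower_spectrum_necessary:
  assumes nonneg: "\<And>\<theta>. \<theta> \<in> {0<..1} \<Longrightarrow> 0 \<le> \<phi> \<theta>" and d: "0 \<le> d"
    and spec: "\<And>\<theta>. \<theta> \<in> {0<..1} \<Longrightarrow> scaled_lower_spectrum \<theta> X = ereal (\<phi> \<theta>)"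
  shows "d-lipschitz_on {0<..1} \<phi>"
    and "\<forall>\<kappa>\<in>{0<..1}. \<forall>\<theta>\<in>{0<..1}. \<phi> \<theta> \<le> \<phi> (\<kappa> * \<theta>) - \<theta> * \<phi> \<kappa>"
proof -
  have growth: "growth_at_least \<theta> c \<longleftrightarrow> c \<le> \<phi> \<theta>" if "\<theta> \<in> {0<..1}" for \<theta> c
    using le_scaled_lower_spectrum_iff[OF that, of c] spec[OF that] by simp
  have one: "\<phi> 1 = 0" using spec[of 1] by (simp add: scaled_lower_spectrum_def)
  have super: "\<phi> \<theta> \<le> \<phi> (\<kappa> * \<theta>) - \<theta> * \<phi> \<kappa>" if "\<kappa> \<in> {0<..1}" "\<theta> \<in> {0<..1}" for \<kappa> \<theta>
  proof (cases "\<kappa> = 1 \<or> \<theta> = 1")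
    case True
    then show ?thesis using one by auto
  next
    case False
    then have "growth_at_least (\<kappa> * \<theta>) (\<phi> \<theta> + \<theta> * \<phi> \<kappa>)"
      using that growth[of \<kappa>] growth[of \<theta>] by (intro growth_superadditive) auto
    moreover have "\<kappa> * \<theta> \<in> {0<..1}" using that by (simp add: mult_le_one)
    ultimately show ?thesis using growth by force
  qed
  then show "\<forall>\<kappa>\<in>{0<..1}. \<forall>\<theta>\<in>{0<..1}. \<phi> \<theta> \<le> \<phi> (\<kappa> * \<theta>) - \<theta> * \<phi> \<kappa>" by blast
  \<comment> \<open>Monotonicity is superadditivity with the ratio \<open>\<kappa> / \<theta>\<close>, and gives one half of the Lipschitz bound.\<close>
  have mono: "\<phi> \<theta> \<le> \<phi> \<kappa>" if "\<kappa> \<in> {0<..1}" "\<theta> \<in> {0<..1}" "\<kappa> \<le> \<theta>" for \<kappa> \<theta>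
  proof -
    have q: "\<kappa> / \<theta> \<in> {0<..1}" using that by auto
    have "0 \<le> \<theta> * \<phi> (\<kappa> / \<theta>)" using nonneg[OF q] that by simp
    moreover have "\<phi> \<theta> \<le> \<phi> \<kappa> - \<theta> * \<phi> (\<kappa> / \<theta>)" using super[OF q that(2)] that by simp
    ultimately show ?thesis by simp
  qed
  have lip: "\<phi> \<kappa> - d * (\<theta> - \<kappa>) \<le> \<phi> \<theta>" if "\<kappa> \<in> {0<..1}" "\<theta> \<in> {0<..1}" "\<kappa> \<le> \<theta>" for \<kappa> \<theta>
    using growth_lipschitz[of \<kappa> \<theta> "\<phi> \<kappa>"] growth[of \<kappa> "\<phi> \<kappa>"] growth[of \<theta>] that by auto
  show "d-lipschitz_on {0<..1} \<phi>"
  proof (rule lipschitz_onI)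
    fix x y :: real assume xy: "x \<in> {0<..1}" "y \<in> {0<..1}"
    show "dist (\<phi> x) (\<phi> y) \<le> d * dist x y"
      using xy mono[of x y] lip[of x y] mono[of y x] lip[of y x]
      by (cases "x \<le> y") (auto simp: dist_real_def)
  qed (rule d)
qed

end


section \<open>A growth function with prescribed lower growth rates\<close>

locale rate_function =
  fixes \<phi> :: "real \<Rightarrow> real" and d :: real
  assumes d_pos: "0 < d"
    and range: "\<And>\<theta>. \<theta> \<in> {0<..1} \<Longrightarrow> 0 \<le> \<phi> \<theta> \<and> \<phi> \<theta> \<le> d"
    and lipschitz: "d-lipschitz_on {0<..1} \<phi>"
    and super: "\<And>\<kappa> \<theta>. \<kappa> \<in> {0<..1} \<Longrightarrow> \<theta> \<in> {0<..1} \<Longrightarrow> \<phi> \<theta> \<le> \<phi> (\<kappa> * \<theta>) - \<theta> * \<phi> \<kappa>"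
begin

lemma rate_one: "\<phi> 1 = 0"
  using super[of 1 1] range[of 1] by simp

lemma rate_antimono:
  assumes "0 < x" "x \<le> y" "y \<le> 1"
  shows "\<phi> y \<le> \<phi> x"
proof -
  have q: "x / y \<in> {0<..1}" using assms by auto
  have "0 \<le> y * \<phi> (x / y)" using range[OF q] assms by simp
  moreover have "\<phi> y \<le> \<phi> x - y * \<phi> (x / y)" using super[OF q, of y] assms by simp
  ultimately show ?thesis by simp
qed

lemma rate_lipschitz:
  assumes "0 < x" "x \<le> y" "y \<le> 1"
  shows "\<phi> x \<le> \<phi> y + d * (y - x)"
  using lipschitz_onD[OF lipschitz, of x y] assms by (auto simp: dist_real_def abs_if split: if_splits)

lemma rate_le: "\<theta> \<in> {0<..1} \<Longrightarrow> \<phi> \<theta> \<le> d * (1 - \<theta>)"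
  using rate_lipschitz[of \<theta> 1] rate_one by simp

text \<open>This is the limit of \<open>\<phi>\<close> at \<open>0\<close>, because \<open>\<phi>\<close> is decreasing.\<close>

definition rate_sup :: real where
  "rate_sup = (SUP x\<in>{0<..1}. \<phi> x)"

lemma rate_le_sup: "\<theta> \<in> {0<..1} \<Longrightarrow> \<phi> \<theta> \<le> rate_sup"
  unfolding rate_sup_def using range by (intro cSUP_upper bdd_aboveI2[where M = d]) auto

lemma rate_sup_le:
  assumes "x \<in> {0<..1}"
  shows "rate_sup \<le> \<phi> x + d * x"
  unfolding rate_sup_def
proof (rule cSUP_least)
  fix z :: real assume z: "z \<in> {0<..1}"
  show "\<phi> z \<le> \<phi> x + d * x"
  proof (cases "z \<le> x")
    case True
    have "d * (x - z) \<le> d * x" using d_pos z by (intro mult_left_mono) auto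
    then show ?thesis using rate_lipschitz[of z x] z assms True by simp
  next
    case False
    moreover have "0 \<le> d * x" using d_pos assms by simp
    ultimately show ?thesis using rate_antimono[of x z] z assms by simp
  qed
qed simp

lemma rate_sup_bounds: "0 \<le> rate_sup" "rate_sup \<le> d"
  using rate_le_sup[of 1] rate_sup_le[of 1] by (simp_all add: rate_one)

text \<open>The profile is the growth function, normalised to attain the rates exactly at \<open>x = 1\<close>: its gap
  between \<open>\<theta>\<close> and \<open>1\<close> is \<open>\<phi> \<theta>\<close>. Beyond \<open>1\<close> it has the greatest slope \<open>d\<close> that a growth function
  in dimension \<open>d\<close> can have.\<close>

definition profile :: "real \<Rightarrow> real" where
  "profile x = (if x \<le> 0 then 0 else if x \<le> 1 then rate_sup - \<phi> x else rate_sup + d * (x - 1))"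

lemma profile_mono_lipschitz:
  assumes "0 \<le> x" "x \<le> y"
  shows "profile x \<le> profile y" "profile y \<le> profile x + d * (y - x)"
proof -
  consider "y = 0" | "x = 0" "0 < y" "y \<le> 1" | "x = 0" "1 < y" | "0 < x" "y \<le> 1" | "0 < x" "x \<le> 1" "1 < y" | "1 < x"
    using assms by linarith
  then have "profile x \<le> profile y \<and> profile y \<le> profile x + d * (y - x)"
  proof cases
    case 1 then show ?thesis using assms by (simp add: profile_def)
  next
    case 2 then show ?thesis using rate_le_sup[of y] rate_sup_le[of y] by (simp add: profile_def)
  next
    case 3
    then have "0 \<le> d * (y - 1)" using d_pos by simp
    then show ?thesis using 3 rate_sup_bounds by (simp add: profile_def algebra_simps)
  next
    case 4 then show ?thesis
      using rate_antimono[of x y] rate_lipschitz[of x y] assms by (simp add: profile_def)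
  next
    case 5
    then have "0 \<le> d * (y - 1)" using d_pos by simp
    then show ?thesis
      using 5 rate_le[of x] range[of x] by (simp add: profile_def algebra_simps)
  next
    case 6
    then have "d * (x - 1) \<le> d * (y - 1)" using assms d_pos by (intro mult_left_mono) auto
    then show ?thesis using 6 assms by (simp add: profile_def algebra_simps)
  qed
  then show "profile x \<le> profile y" "profile y \<le> profile x + d * (y - x)" by blast+
qed

lemma profile_nonneg: "0 \<le> x \<Longrightarrow> 0 \<le> profile x"
  using profile_mono_lipschitz[of 0 x] by (simp add: profile_def)

lemma profile_le: "0 \<le> x \<Longrightarrow> profile x \<le> d * x"
  using profile_mono_lipschitz[of 0 x] by (simp add: profile_def)

lemma profile_ge:
  assumes "0 \<le> x"
  shows "d * (x - 1) \<le> profile x"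
proof (cases "x \<le> 1")
  case True
  then have "d * (x - 1) \<le> 0" using d_pos by (simp add: mult_le_0_iff)
  then show ?thesis using profile_nonneg[OF assms] by simp
next
  case False
  then show ?thesis using rate_sup_bounds by (simp add: profile_def)
qed

lemma profile_gap_one: "\<theta> \<in> {0<..1} \<Longrightarrow> profile 1 - profile \<theta> = \<phi> \<theta>"
  by (auto simp: profile_def rate_one)

text \<open>At \<open>x \<le> 1\<close> this is the functional inequality of \<open>\<phi>\<close> with the roles of ratio and scale
  exchanged. At \<open>x > 1\<close> it follows from \<open>\<phi>\<close> being \<open>d\<close>-Lipschitz with \<open>\<phi> 1 = 0\<close>.\<close>

lemma profile_gap:
  assumes x: "0 < x" and \<theta>: "\<theta> \<in> {0<..1}"
  shows "\<phi> \<theta> * x \<le> profile x - profile (\<theta> * x)"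
proof -
  have pos: "0 < \<theta> * x" using assms by simp
  have le: "\<theta> * x \<le> x" using assms by simp
  consider "x \<le> 1" | "1 < \<theta> * x" | "1 < x" "\<theta> * x \<le> 1" by linarith
  then show ?thesis
  proof cases
    case 1
    have "\<phi> x \<le> \<phi> (\<theta> * x) - x * \<phi> \<theta>" using super[OF \<theta>, of x] x 1 by simp
    then show ?thesis using 1 x pos le by (simp add: profile_def mult.commute)
  next
    case 2
    have "\<phi> \<theta> * x \<le> d * (1 - \<theta>) * x" using rate_le[OF \<theta>] x by (intro mult_right_mono) auto
    then show ?thesis using 2 x pos le by (simp add: profile_def algebra_simps)
  next
    case 3
    \<comment> \<open>Split \<open>\<phi> \<theta> * x\<close> as \<open>\<phi> \<theta>\<close>, compared with \<open>\<phi> (\<theta> * x)\<close>, and \<open>\<phi> \<theta> * (x - 1)\<close>, compared with \<open>\<phi> 1\<close>.\<close>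
    have "\<theta> \<le> \<theta> * x" using 3 \<theta> by simp
    then have "\<phi> \<theta> \<le> \<phi> (\<theta> * x) + d * (\<theta> * x - \<theta>)" using rate_lipschitz[of \<theta> "\<theta> * x"] 3 \<theta> by simp
    moreover have "\<phi> \<theta> * (x - 1) \<le> d * (1 - \<theta>) * (x - 1)"
      using rate_le[OF \<theta>] 3 by (intro mult_right_mono) auto
    ultimately show ?thesis using 3 x pos by (simp add: profile_def algebra_simps)
  qed
qed

text \<open>The profile attains its rates only at one scale; each branch moves this scale to \<open>fact k\<close>. The
  additive constant keeps branch \<open>k\<close> above its predecessor up to about the scale \<open>fact (k - 1)\<close>, and
  \<open>fact (k - 1) / fact k\<close> tends to \<open>0\<close>, so that it is negligible at scale \<open>fact k\<close>.\<close>

definition branch :: "nat \<Rightarrow> real \<Rightarrow> real" where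
  "branch k t = fact k * profile (t / fact k) + d * fact (k - 1)"

definition growth :: "real \<Rightarrow> real" where
  "growth t = (INF k. branch k t)"

lemma branch_nonneg: "0 \<le> t \<Longrightarrow> 0 \<le> branch k t"
  unfolding branch_def using profile_nonneg[of "t / fact k"] d_pos by simp

lemma growth_le_branch: "0 \<le> t \<Longrightarrow> growth t \<le> branch k t"
  unfolding growth_def using branch_nonneg by (intro cINF_lower bdd_belowI2[where m = 0]) auto

lemma le_growthI: "(\<And>k. c \<le> branch k t) \<Longrightarrow> c \<le> growth t"
  unfolding growth_def by (intro cINF_greatest) auto

lemma growth_mono:
  assumes "0 \<le> x" "x \<le> y"
  shows "growth x \<le> growth y"
proof (rule le_growthI)
  fix k
  have "x / fact k \<le> y / fact k" using assms by (simp add: divide_right_mono)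
  then have "branch k x \<le> branch k y"
    unfolding branch_def using profile_mono_lipschitz(1)[of "x / fact k" "y / fact k"] assms by simp
  then show "growth x \<le> branch k y" using growth_le_branch[OF assms(1), of k] by simp
qed

lemma growth_lipschitz:
  assumes "0 \<le> x" "x \<le> y"
  shows "growth y \<le> growth x + d * (y - x)"
proof -
  have "growth y - d * (y - x) \<le> growth x"
  proof (rule le_growthI)
    fix k
    let ?n = "fact k :: real"
    have le: "x / ?n \<le> y / ?n" using assms by (simp add: divide_right_mono)
    have "?n * profile (y / ?n) \<le> ?n * (profile (x / ?n) + d * (y / ?n - x / ?n))"
      using profile_mono_lipschitz(2)[OF _ le] assms by (intro mult_left_mono) auto
    also have "\<dots> = ?n * profile (x / ?n) + d * (y - x)" by (simp add: field_simps)
    finally have "branch k y \<le> branch k x + d * (y - x)" by (simp add: branch_def)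
    then show "growth y - d * (y - x) \<le> branch k x" using growth_le_branch[of y k] assms by simp
  qed
  then show ?thesis by simp
qed

text \<open>Each branch inherits the gaps of the profile by scaling, and lower bounds on the gaps
  \<open>f u - f (\<theta> * u)\<close> survive passing to an infimum of functions \<open>f\<close>.\<close>

lemma growth_gap:
  assumes u: "0 < u" and \<theta>: "\<theta> \<in> {0<..1}"
  shows "\<phi> \<theta> * u \<le> growth u - growth (\<theta> * u)"
proof -
  have "growth (\<theta> * u) + \<phi> \<theta> * u \<le> growth u"
  proof (rule le_growthI)
    fix k
    let ?n = "fact k :: real"
    have "?n * (\<phi> \<theta> * (u / ?n)) \<le> ?n * (profile (u / ?n) - profile (\<theta> * (u / ?n)))"
      using profile_gap[OF _ \<theta>, of "u / ?n"] u by (intro mult_left_mono) auto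
    then have "branch k (\<theta> * u) + \<phi> \<theta> * u \<le> branch k u"
      by (simp add: branch_def algebra_simps)
    then show "growth (\<theta> * u) + \<phi> \<theta> * u \<le> branch k u"
      using growth_le_branch[of "\<theta> * u" k] u \<theta> by simp
  qed
  then show ?thesis by simp
qed

text \<open>At \<open>t = \<theta> * fact k\<close> no branch lies much below the \<open>k\<close>-th: the earlier ones have
  slope \<open>d\<close> from \<open>fact (k - 1)\<close> on, and the later ones are at least \<open>d * fact k\<close> by their additive
  constants alone.\<close>

lemma growth_gap_fact:
  assumes k: "1 \<le> k" and \<theta>: "\<theta> \<in> {0<..1}"
  shows "growth (fact k) - growth (\<theta> * fact k) \<le> \<phi> \<theta> * fact k + 2 * d * fact (k - 1)"
proof -
  let ?u = "fact k :: real"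
  have t: "0 \<le> \<theta> * ?u" using \<theta> by simp
  have k1: "0 \<le> d * fact (k - 1)" using d_pos by simp
  have "?u * profile \<theta> - d * fact (k - 1) \<le> growth (\<theta> * ?u)"
  proof (rule le_growthI)
    fix j
    have p: "?u * profile \<theta> \<le> d * (\<theta> * ?u)"
      using mult_left_mono[OF profile_le[of \<theta>], of ?u] \<theta> by (simp add: mult_ac)
    consider "j < k" | "j = k" | "k < j" by linarith
    then show "?u * profile \<theta> - d * fact (k - 1) \<le> branch j (\<theta> * ?u)"
    proof cases
      case 1
      have "d * (\<theta> * ?u - fact j) = fact j * (d * (\<theta> * ?u / fact j - 1))" by (simp add: field_simps)
      also have "\<dots> \<le> fact j * profile (\<theta> * ?u / fact j)"
        using profile_ge[of "\<theta> * ?u / fact j"] t by (intro mult_left_mono) auto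
      also have "\<dots> \<le> branch j (\<theta> * ?u)" using d_pos by (simp add: branch_def)
      finally have "d * (\<theta> * ?u) - d * fact j \<le> branch j (\<theta> * ?u)" by (simp add: algebra_simps)
      moreover have "d * fact j \<le> d * fact (k - 1)"
        using 1 d_pos by (intro mult_left_mono fact_mono) auto
      ultimately show ?thesis using p by linarith
    next
      case 2
      have "?u * profile \<theta> \<le> branch j (\<theta> * ?u)" using 2 k1 by (simp add: branch_def)
      then show ?thesis using k1 by linarith
    next
      case 3
      have "d * (\<theta> * ?u) \<le> d * (1 * ?u)" using d_pos \<theta> by (intro mult_left_mono mult_right_mono) auto
      also have "\<dots> \<le> d * fact (j - 1)" unfolding mult_1 using 3 d_pos by (intro mult_left_mono fact_mono) auto
      also have "\<dots> \<le> branch j (\<theta> * ?u)"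
        unfolding branch_def using profile_nonneg[of "\<theta> * ?u / fact j"] t by simp
      finally show ?thesis using p k1 by linarith
    qed
  qed
  moreover have "growth ?u \<le> ?u * profile 1 + d * fact (k - 1)"
    using growth_le_branch[of ?u k] by (simp add: branch_def)
  moreover have "?u * profile 1 - ?u * profile \<theta> = \<phi> \<theta> * ?u"
    using profile_gap_one[OF \<theta>] by (simp add: algebra_simps)
  ultimately show ?thesis by (simp add: algebra_simps)
qed

end


section \<open>Counting in Euclidean space\<close>

lemma dist_le_coordinates:
  fixes y z :: "real ^ 'n"
  assumes "\<And>i. \<bar>y $ i - z $ i\<bar> \<le> e"
  shows "dist y z \<le> real CARD('n) * e"
proof -
  have "dist y z \<le> (\<Sum>i\<in>UNIV. \<bar>(y - z) $ i\<bar>)" unfolding dist_norm by (rule norm_le_l1_cart)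
  also have "\<dots> \<le> (\<Sum>i\<in>(UNIV::'n set). e)" using assms by (intro sum_mono) simp
  finally show ?thesis by simp
qed

lemma coordinate_dist_le:
  fixes y z :: "real ^ 'n"
  shows "\<bar>y $ i - z $ i\<bar> \<le> dist y z"
  using dist_vec_nth_le[of y i z] by (simp add: dist_real_def)

lemma card_le_two_power: "real CARD('n::finite) * (2 powr - (a + real CARD('n))) \<le> 2 powr - a"
proof -
  have "real CARD('n) \<le> 2 ^ CARD('n)" using less_exp[of "CARD('n)"] by (simp flip: of_nat_le_iff)
  then have "real CARD('n) * (2 powr - (a + real CARD('n))) \<le> 2 ^ CARD('n) * (2 powr - (a + real CARD('n)))"
    by (intro mult_right_mono) auto
  also have "\<dots> = 2 powr - a" by (simp add: powr_diff powr_realpow)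
  finally show ?thesis .
qed

text \<open>Sorting the points of a ball by a grid of small cubes.\<close>

lemma upper_beta_euclidean:
  fixes X :: "(real ^ 'n) set"
  assumes "v \<le> u"
  shows "upper_beta X u v \<le> ereal (real CARD('n) * (u - v) + real CARD('n) * log 2 (4 * real CARD('n)))"
  unfolding upper_beta_le_iff
proof
  fix x assume "x \<in> X"
  let ?d = "real CARD('n)"
  define s where "s = 2 powr - u / ?d"
  define t where "t = ?d * 2 powr (u - v)"
  have d1: "1 \<le> ?d" by (simp add: Suc_le_eq)
  have s: "s > 0" using d1 by (simp add: s_def)
  have t1: "1 \<le> t"
    unfolding t_def using mult_mono[OF d1, of 1 "2 powr (u - v)"] assms by (simp add: ge_one_powr_ge_zero)
  define R where "R = {\<lfloor>- t\<rfloor>..\<lfloor>t\<rfloor>}"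
  define q where "q y = (\<lambda>i. \<lfloor>(y $ i - x $ i) / s\<rfloor>)" for y :: "real ^ 'n"
  let ?E = "rel_cball X x (2 powr - v)"
  have sub: "q ` ?E \<subseteq> PiE UNIV (\<lambda>_. R)"
  proof
    fix p assume "p \<in> q ` ?E"
    then obtain y where y: "dist x y \<le> 2 powr - v" "p = q y" by (auto simp: rel_cball_def)
    have "\<bar>y $ i - x $ i\<bar> / s \<le> 2 powr - v / s" for i
      using coordinate_dist_le[of y i x] y(1) s by (intro divide_right_mono) (auto simp: dist_commute)
    moreover have "2 powr - v / s = t" by (simp add: s_def t_def powr_diff powr_minus field_simps)
    ultimately have "\<bar>(y $ i - x $ i) / s\<bar> \<le> t" for i using s by simp
    then have "- t \<le> (y $ i - x $ i) / s" "(y $ i - x $ i) / s \<le> t" for i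
      by (simp_all only: abs_le_iff minus_le_iff)
    then have "q y i \<in> R" for i
      unfolding q_def R_def atLeastAtMost_iff using floor_mono by blast
    then show "p \<in> PiE UNIV (\<lambda>_. R)" using y(2) by auto
  qed
  have close: "dist y z \<le> 2 powr - u" if "q y = q z" for y z
  proof -
    have "\<bar>y $ i - z $ i\<bar> \<le> s" for i
    proof -
      have "\<lfloor>(y $ i - x $ i) / s\<rfloor> = \<lfloor>(z $ i - x $ i) / s\<rfloor>" using that by (simp add: q_def fun_eq_iff)
      then have "\<bar>(y $ i - x $ i) / s - (z $ i - x $ i) / s\<bar> \<le> 1" by linarith
      moreover have "(y $ i - x $ i) / s - (z $ i - x $ i) / s = (y $ i - z $ i) / s"
        by (simp add: diff_divide_distrib)
      ultimately show ?thesis using s by simp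
    qed
    then have "dist y z \<le> ?d * s" by (rule dist_le_coordinates)
    then show ?thesis by (simp add: s_def)
  qed
  have fin: "finite (PiE (UNIV::'n set) (\<lambda>_. R))" by (intro finite_PiE) (auto simp: R_def)
  have "?E \<subseteq> X" by (auto simp: rel_cball_def)
  then obtain C where C: "is_cover X (2 powr - u) ?E C" "card C \<le> card (PiE (UNIV::'n set) (\<lambda>_. R))"
    using cover_by_classes[OF _ fin sub] close by blast
  have "card (PiE (UNIV::'n set) (\<lambda>_. R)) = card R ^ CARD('n)" by (simp add: card_PiE)
  moreover have "real (card R) \<le> 4 * t"
    unfolding R_def using t1 by simp linarith
  ultimately have "real (card C) \<le> (4 * t) ^ CARD('n)"
    using C(2) power_mono[of "real (card R)" "4 * t" "CARD('n)"] by (simp flip: of_nat_power)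
  also have "\<dots> = (2 powr (log 2 (4 * ?d) + (u - v))) ^ CARD('n)"
    using d1 by (simp add: t_def powr_add mult.assoc)
  also have "\<dots> = 2 powr (?d * (u - v) + ?d * log 2 (4 * ?d))"
    by (simp add: powr_powr algebra_simps flip: powr_realpow)
  finally show "\<exists>C. is_cover X (2 powr - u) ?E C
      \<and> real (card C) \<le> 2 powr (?d * (u - v) + ?d * log 2 (4 * ?d))"
    using C(1) by blast
qed

lemma doubling_set_euclidean:
  fixes X :: "(real ^ 'n) set"
  assumes "X \<noteq> {}"
  shows "doubling_set X (real CARD('n)) (real CARD('n) * log 2 (4 * real CARD('n)))"
  using assms upper_beta_euclidean by unfold_locales

section \<open>Sets of reals with restricted binary digits\<close>

text \<open>The digit of weight \<open>2 ^ - (m + 1)\<close> is free for \<open>m \<in> M\<close> and \<open>0\<close> otherwise. It is the parity of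
  \<open>\<lfloor>2 ^ (m + 1) * y\<rfloor>\<close>, which settles the choice between the two expansions of a dyadic rational.\<close>

definition digit_set :: "nat set \<Rightarrow> real set" where
  "digit_set M = {y. 0 \<le> y \<and> y < 1 \<and> (\<forall>m. m \<notin> M \<longrightarrow> even \<lfloor>2 ^ Suc m * y\<rfloor>)}"

text \<open>The dyadic interval of generation \<open>b\<close> determines those of all earlier generations.\<close>

lemma floor_coarser:
  fixes y :: real
  assumes "i \<le> b"
  shows "\<lfloor>2 ^ i * y\<rfloor> = \<lfloor>2 ^ b * y\<rfloor> div 2 ^ (b - i)"
proof -
  have "(2::real) ^ b = 2 ^ i * 2 ^ (b - i)" using assms by (simp flip: power_add)
  then have "2 ^ i * y = (2 ^ b * y) / real_of_int (2 ^ (b - i))" by simp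
  then show ?thesis using floor_divide_real_eq_div[of "2 ^ (b - i)" "2 ^ b * y"] by simp
qed

lemma zero_in_digit_set: "0 \<in> digit_set M"
  by (simp add: digit_set_def)

text \<open>Truncating a binary expansion only replaces digits by \<open>0\<close>.\<close>

lemma truncation_in_digit_set:
  assumes "x \<in> digit_set M"
  shows "real_of_int \<lfloor>2 ^ a * x\<rfloor> / 2 ^ a \<in> digit_set M"
proof -
  let ?p = "real_of_int \<lfloor>2 ^ a * x\<rfloor> / 2 ^ a"
  have x: "0 \<le> x" "x < 1" using assms by (auto simp: digit_set_def)
  have "?p \<le> x" by (simp add: divide_le_eq mult.commute)
  then have "?p < 1" using x by linarith
  moreover have "0 \<le> ?p" using x by simp
  moreover have "even \<lfloor>2 ^ Suc m * ?p\<rfloor>" if "m \<notin> M" for m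
  proof (cases "Suc m \<le> a")
    case True
    have "\<lfloor>2 ^ Suc m * ?p\<rfloor> = \<lfloor>2 ^ Suc m * x\<rfloor>"
      using floor_coarser[OF True, of ?p] floor_coarser[OF True, of x] by simp
    then show ?thesis using assms that by (simp add: digit_set_def)
  next
    case False
    then obtain n where n: "Suc m = a + Suc n" using less_imp_Suc_add[of a "Suc m"] by force
    have "2 ^ Suc m * ?p = real_of_int (2 ^ Suc n * \<lfloor>2 ^ a * x\<rfloor>)" unfolding n by (simp add: power_add)
    then show ?thesis by (simp only: floor_of_int) simp
  qed
  ultimately show ?thesis unfolding digit_set_def by blast
qed

text \<open>A dyadic point stays in its dyadic intervals of generation up to \<open>b\<close> when a digit is appended, so
  that only the new digit has to be checked.\<close>

lemma append_digit:
  assumes j: "real_of_int j / 2 ^ b \<in> digit_set M" and e: "e = 0 \<or> e = 1 \<and> b \<in> M"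
  shows "real_of_int (2 * j + e) / 2 ^ Suc b \<in> digit_set M"
    and "i \<le> b \<Longrightarrow> \<lfloor>2 ^ i * (real_of_int (2 * j + e) / 2 ^ Suc b)\<rfloor> = \<lfloor>2 ^ i * (real_of_int j / 2 ^ b)\<rfloor>"
proof -
  let ?y = "real_of_int (2 * j + e) / 2 ^ Suc b" and ?z = "real_of_int j / 2 ^ b"
  have y: "\<lfloor>2 ^ Suc b * ?y\<rfloor> = 2 * j + e"
  proof -
    have "2 ^ Suc b * ?y = real_of_int (2 * j + e)" by simp
    then show ?thesis by (simp only: floor_of_int)
  qed
  have z: "\<lfloor>2 ^ b * ?z\<rfloor> = j" by simp
  have yb: "\<lfloor>2 ^ b * ?y\<rfloor> = j"
    using floor_coarser[of b "Suc b" ?y] y e by auto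
  show same: "\<lfloor>2 ^ i * ?y\<rfloor> = \<lfloor>2 ^ i * ?z\<rfloor>" if "i \<le> b" for i
    using floor_coarser[OF that, of ?y] floor_coarser[OF that, of ?z] yb z by simp
  have "0 \<le> ?z" "?z < 1" using j by (simp_all add: digit_set_def)
  then have "0 \<le> ?z * 2 ^ b" "?z * 2 ^ b < 1 * 2 ^ b"
    by (intro mult_nonneg_nonneg mult_strict_right_mono; simp)+
  then have "0 \<le> real_of_int j" "real_of_int j < real_of_int (2 ^ b)" by simp_all
  then have j0: "0 \<le> j" "j < 2 ^ b" by (simp_all only: of_int_less_iff of_int_0_le_iff)
  show "?y \<in> digit_set M"
    unfolding digit_set_def
  proof (intro CollectI conjI allI impI)
    show "0 \<le> ?y" using j0 e by auto
    have "2 * j + e < 2 ^ Suc b" using j0 e by auto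
    then have "real_of_int (2 * j + e) < real_of_int (2 ^ Suc b)" by (simp only: of_int_less_iff)
    then show "?y < 1" by (simp add: divide_less_eq_1)
    fix m assume m: "m \<notin> M"
    consider "Suc m \<le> b" | "m = b" | "b < m" by linarith
    then show "even \<lfloor>2 ^ Suc m * ?y\<rfloor>"
    proof cases
      case 1
      then show ?thesis using same[OF 1] j m by (simp add: digit_set_def)
    next
      case 2
      then show ?thesis using y e m by auto
    next
      case 3
      then obtain n where n: "Suc m = Suc b + Suc n" using less_imp_Suc_add by force
      have "2 ^ Suc m * ?y = real_of_int (2 ^ Suc n * (2 * j + e))"
        unfolding n by (simp add: power_add)
      then show ?thesis by (simp only: floor_of_int) simp
    qed
  qed
qed

lemma free_digits_Suc:
  assumes "a \<le> b"
  shows "card (M \<inter> {a..<Suc b}) = card (M \<inter> {a..<b}) + (if b \<in> M then 1 else 0)"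
proof -
  have "M \<inter> {a..<Suc b} = (if b \<in> M then insert b (M \<inter> {a..<b}) else M \<inter> {a..<b})"
    using assms by (auto simp: less_Suc_eq)
  then show ?thesis by simp
qed

text \<open>In passing from generation \<open>b\<close> to \<open>b + 1\<close> the number of dyadic intervals that meet the set is at
  most doubled if the digit is free and does not grow otherwise.\<close>

lemma digit_set_classes_le:
  assumes "a \<le> b"
  shows "finite ((\<lambda>y. \<lfloor>2 ^ b * y\<rfloor>) ` {y \<in> digit_set M. \<lfloor>2 ^ a * y\<rfloor> = k}) \<and>
    card ((\<lambda>y. \<lfloor>2 ^ b * y\<rfloor>) ` {y \<in> digit_set M. \<lfloor>2 ^ a * y\<rfloor> = k}) \<le> 2 ^ card (M \<inter> {a..<b})"
  using assms
proof (induction b rule: dec_induct)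
  case base
  have sub: "(\<lambda>y. \<lfloor>2 ^ a * y\<rfloor>) ` {y \<in> digit_set M. \<lfloor>2 ^ a * y\<rfloor> = k} \<subseteq> {k}" by auto
  then show ?case using card_mono[OF _ sub] finite_subset[OF sub] by simp
next
  case (step b)
  let ?I = "\<lambda>b. (\<lambda>y. \<lfloor>2 ^ b * y\<rfloor>) ` {y \<in> digit_set M. \<lfloor>2 ^ a * y\<rfloor> = k}"
  let ?J = "(\<lambda>j. 2 * j) ` ?I b \<union> (if b \<in> M then (\<lambda>j. 2 * j + 1) ` ?I b else {})"
  have fin: "finite ?J" using step.IH by simp
  have sub: "?I (Suc b) \<subseteq> ?J"
  proof
    fix p assume "p \<in> ?I (Suc b)"
    then obtain y where y: "y \<in> digit_set M" "\<lfloor>2 ^ a * y\<rfloor> = k" "p = \<lfloor>2 ^ Suc b * y\<rfloor>" by blast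
    have "p div 2 = \<lfloor>2 ^ b * y\<rfloor>" using y(3) floor_coarser[of b "Suc b" y] by simp
    then have j: "p div 2 \<in> ?I b" using y(1,2) by blast
    show "p \<in> ?J"
    proof (cases "even p")
      case True
      then have "p = 2 * (p div 2)" by simp
      then show ?thesis using j by blast
    next
      case False
      then have "b \<in> M" using y by (auto simp: digit_set_def)
      moreover have "p = 2 * (p div 2) + 1" using False by presburger
      ultimately show ?thesis using j by auto
    qed
  qed
  have "card (?I (Suc b)) \<le> card ?J" by (rule card_mono[OF fin sub])
  also have "\<dots> \<le> card ((\<lambda>j. 2 * j) ` ?I b) + card (if b \<in> M then (\<lambda>j. 2 * j + 1) ` ?I b else {})"
    by (rule card_Un_le)
  also have "\<dots> \<le> card (?I b) + (if b \<in> M then card (?I b) else 0)"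
    using step.IH card_image_le by (auto intro!: add_mono)
  also have "\<dots> \<le> 2 ^ card (M \<inter> {a..<Suc b})"
    using step.IH free_digits_Suc[OF step.hyps(1), of M] by auto
  finally show ?case using finite_subset[OF sub fin] by blast
qed

text \<open>Conversely, every choice of the free digits between \<open>a\<close> and \<open>b\<close> is realised by a point with
  vanishing later digits. These points are multiples of \<open>2 ^ - b\<close>, which makes them well separated;
  points chosen arbitrarily from adjacent dyadic intervals need not be.\<close>

lemma digit_set_points_ge:
  assumes "a \<le> b" "x \<in> digit_set M"
  shows "\<exists>W::int set. finite W \<and> card W = 2 ^ card (M \<inter> {a..<b}) \<and>
    (\<forall>j\<in>W. real_of_int j / 2 ^ b \<in> digit_set M \<and> \<lfloor>2 ^ a * (real_of_int j / 2 ^ b)\<rfloor> = \<lfloor>2 ^ a * x\<rfloor>)"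
  using assms(1)
proof (induction b rule: dec_induct)
  case base
  show ?case
    using truncation_in_digit_set[OF assms(2), of a] by (intro exI[of _ "{\<lfloor>2 ^ a * x\<rfloor>}"]) simp
next
  case (step b)
  then obtain W :: "int set" where W: "finite W" "card W = 2 ^ card (M \<inter> {a..<b})"
    "\<And>j. j \<in> W \<Longrightarrow> real_of_int j / 2 ^ b \<in> digit_set M \<and> \<lfloor>2 ^ a * (real_of_int j / 2 ^ b)\<rfloor> = \<lfloor>2 ^ a * x\<rfloor>"
    by blast
  let ?D = "if b \<in> M then {0, 1} else {0::int}"
  let ?g = "\<lambda>(j, e). 2 * j + e :: int"
  have "inj_on ?g (W \<times> ?D)"
    by (auto simp: inj_on_def split: if_splits) presburger+
  then have "card (?g ` (W \<times> ?D)) = card W * card ?D"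
    by (simp only: card_image card_cartesian_product)
  also have "\<dots> = 2 ^ card (M \<inter> {a..<Suc b})"
    using free_digits_Suc[OF step.hyps(1), of M] W(2) by auto
  finally have card: "card (?g ` (W \<times> ?D)) = 2 ^ card (M \<inter> {a..<Suc b})" .
  show ?case
  proof (intro exI[of _ "?g ` (W \<times> ?D)"] conjI ballI card)
    show "finite (?g ` (W \<times> ?D))" using W(1) by simp
    fix p assume "p \<in> ?g ` (W \<times> ?D)"
    then obtain j e where p: "p = 2 * j + e" "j \<in> W" "e \<in> ?D" by auto
    then have e: "e = 0 \<or> e = 1 \<and> b \<in> M" by (auto split: if_splits)
    show "real_of_int p / 2 ^ Suc b \<in> digit_set M"
      "\<lfloor>2 ^ a * (real_of_int p / 2 ^ Suc b)\<rfloor> = \<lfloor>2 ^ a * x\<rfloor>"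
      using append_digit(1)[OF _ e, of j] append_digit(2)[OF _ e, of j a] W(3)[OF p(2)] step.hyps(1)
      unfolding p(1) by simp_all
  qed
qed

section \<open>Homogeneous Cantor sets\<close>

definition cantor_set :: "nat set \<Rightarrow> (real ^ 'n) set" where
  "cantor_set M = {y. \<forall>i. y $ i \<in> digit_set M}"

lemma cantor_set_nonempty: "cantor_set M \<noteq> {}"
proof -
  have "0 \<in> cantor_set M" by (simp add: cantor_set_def zero_in_digit_set)
  then show ?thesis by blast
qed

text \<open>In each coordinate a ball of radius \<open>2 powr - v\<close> meets at most three adjacent dyadic intervals of
  generation \<open>\<lfloor>v\<rfloor>\<close>. The \<open>CARD('n)\<close> additional generations make the diameter of the small cubes at most
  \<open>2 powr - u\<close>. Negative scales are cut off at \<open>0\<close>, since the set has side length at most \<open>1\<close>.\<close>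

lemma upper_beta_cantor_set:
  assumes "v \<le> u"
  shows "upper_beta (cantor_set M :: (real ^ 'n) set) u v
    \<le> ereal (CARD('n) * (2 + card (M \<inter> {nat \<lfloor>v\<rfloor>..<nat \<lceil>u\<rceil> + CARD('n)})))"
  unfolding upper_beta_le_iff
proof
  let ?X = "cantor_set M :: (real ^ 'n) set"
  define a where "a = nat \<lfloor>v\<rfloor>"
  define b where "b = nat \<lceil>u\<rceil> + CARD('n)"
  define c where "c = card (M \<inter> {a..<b})"
  have ab: "a \<le> b" unfolding a_def b_def using assms by linarith
  fix x assume x: "x \<in> ?X"
  define R where "R i = (\<Union>k\<in>{\<lfloor>2 ^ a * x $ i\<rfloor> - 1..\<lfloor>2 ^ a * x $ i\<rfloor> + 1}.
    (\<lambda>y. \<lfloor>2 ^ b * y\<rfloor>) ` {y \<in> digit_set M. \<lfloor>2 ^ a * y\<rfloor> = k})" for i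
  define q where "q y = (\<lambda>i. \<lfloor>2 ^ b * y $ i\<rfloor>)" for y :: "real ^ 'n"
  let ?E = "rel_cball ?X x (2 powr - v)"
  have finR: "finite (R i)" for i unfolding R_def using digit_set_classes_le[OF ab] by blast
  have cardR: "card (R i) \<le> 4 * 2 ^ c" for i
  proof -
    have "card (R i) \<le> (\<Sum>k\<in>{\<lfloor>2 ^ a * x $ i\<rfloor> - 1..\<lfloor>2 ^ a * x $ i\<rfloor> + 1}. 2 ^ c)"
      unfolding R_def c_def
      by (rule order_trans[OF card_UN_le sum_mono]) (use digit_set_classes_le[OF ab] in auto)
    then show ?thesis by simp
  qed
  have sub: "q ` ?E \<subseteq> PiE UNIV R"
  proof
    fix p assume "p \<in> q ` ?E"
    then obtain y where y: "y \<in> ?X" "dist x y \<le> 2 powr - v" "p = q y" by (auto simp: rel_cball_def)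
    have "p i \<in> R i" for i
    proof -
      have mem: "y $ i \<in> digit_set M" "x $ i \<in> digit_set M" using y x by (auto simp: cantor_set_def)
      have "2 ^ a * \<bar>y $ i - x $ i\<bar> \<le> 1"
      proof (cases "v \<le> 0")
        case True
        then show ?thesis using mem by (auto simp: a_def digit_set_def)
      next
        case False
        then have "2 powr real a \<le> 2 powr v" by (simp add: a_def)
        then have "2 ^ a * \<bar>y $ i - x $ i\<bar> \<le> 2 powr v * 2 powr - v"
          using coordinate_dist_le[of y i x] y(2)
          by (intro mult_mono) (auto simp: dist_commute powr_realpow)
        then show ?thesis by (simp flip: powr_add)
      qed
      then have "\<bar>2 ^ a * y $ i - 2 ^ a * x $ i\<bar> \<le> 1"
        by (metis abs_mult abs_numeral abs_power_minus power_abs right_diff_distrib)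
      then have "\<lfloor>2 ^ a * y $ i\<rfloor> \<in> {\<lfloor>2 ^ a * x $ i\<rfloor> - 1..\<lfloor>2 ^ a * x $ i\<rfloor> + 1}"
        unfolding atLeastAtMost_iff by linarith
      then show ?thesis using mem unfolding R_def y(3) q_def by blast
    qed
    then show "p \<in> PiE UNIV R" by auto
  qed
  have close: "dist y z \<le> 2 powr - u" if "q y = q z" for y z
  proof -
    have "\<bar>y $ i - z $ i\<bar> \<le> 2 powr - real b" for i
    proof -
      have "\<lfloor>2 ^ b * y $ i\<rfloor> = \<lfloor>2 ^ b * z $ i\<rfloor>" using that by (simp add: q_def fun_eq_iff)
      then have "\<bar>2 ^ b * y $ i - 2 ^ b * z $ i\<bar> \<le> 1" by linarith
      then have "2 ^ b * \<bar>y $ i - z $ i\<bar> \<le> 1"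
        by (metis abs_mult abs_numeral power_abs right_diff_distrib)
      then show ?thesis by (simp add: powr_minus powr_realpow field_simps)
    qed
    then have "dist y z \<le> real CARD('n) * 2 powr - real b" by (rule dist_le_coordinates)
    also have "\<dots> \<le> 2 powr - real (nat \<lceil>u\<rceil>)"
      using card_le_two_power[where 'n = 'n, of "real (nat \<lceil>u\<rceil>)"] by (simp add: b_def)
    also have "\<dots> \<le> 2 powr - u" by simp linarith
    finally show ?thesis .
  qed
  have fin: "finite (PiE (UNIV::'n set) R)" by (intro finite_PiE finR) simp
  have "?E \<subseteq> ?X" by (auto simp: rel_cball_def)
  then obtain C where C: "is_cover ?X (2 powr - u) ?E C" "card C \<le> card (PiE (UNIV::'n set) R)"
    using cover_by_classes[OF _ fin sub] close by blast
  have "card (PiE (UNIV::'n set) R) \<le> (\<Prod>i\<in>(UNIV::'n set). 4 * 2 ^ c)"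
    unfolding card_PiE[OF finite] by (intro prod_mono) (use cardR in auto)
  then have "card C \<le> (2 ^ (2 + c)) ^ CARD('n)" using C(2) by simp
  then have "real (card C) \<le> real ((2 ^ (2 + c)) ^ CARD('n))" by (simp only: of_nat_le_iff)
  also have "\<dots> = 2 powr real (CARD('n) * (2 + c))"
    by (subst powr_realpow) (simp_all only: of_nat_power of_nat_numeral power_mult[symmetric]
        mult.commute[of "CARD('n)"] zero_less_numeral)
  finally show "\<exists>C. is_cover ?X (2 powr - u) ?E C
      \<and> real (card C) \<le> 2 powr real (CARD('n) * (2 + card (M \<inter> {nat \<lfloor>v\<rfloor>..<nat \<lceil>u\<rceil> + CARD('n)})))"
    using C(1) unfolding c_def a_def b_def by blast
qed

text \<open>Keeping the first \<open>\<lceil>v\<rceil> + CARD('n)\<close> digits of the centre keeps a point within the ball. Varying the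
  digits up to generation \<open>\<lfloor>u\<rfloor> - 3\<close> gives points at distance at least \<open>8 * 2 powr - u\<close>.\<close>

lemma lower_beta_cantor_set:
  assumes "v \<le> u"
  shows "ereal (CARD('n) * card (M \<inter> {nat \<lceil>v\<rceil> + CARD('n)..<nat (\<lfloor>u\<rfloor> - 3)}))
    \<le> lower_beta (cantor_set M :: (real ^ 'n) set) u v"
proof (cases "nat \<lceil>v\<rceil> + CARD('n) < nat (\<lfloor>u\<rfloor> - 3)")
  case False
  then show ?thesis using lower_beta_nonneg by (simp add: zero_ereal_def[symmetric])
next
  case True
  let ?X = "cantor_set M :: (real ^ 'n) set"
  define a where "a = nat \<lceil>v\<rceil> + CARD('n)"
  define b where "b = nat (\<lfloor>u\<rfloor> - 3)"
  define c where "c = card (M \<inter> {a..<b})"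
  have ab: "a \<le> b" using True by (simp add: a_def b_def)
  have "ereal (CARD('n) * c) \<le> lower_beta ?X u v"
    unfolding le_lower_beta_iff
  proof
    fix x assume x: "x \<in> ?X"
    let ?E = "rel_cball ?X x (2 powr - v)"
    have "\<forall>i. \<exists>W::int set. finite W \<and> card W = 2 ^ c \<and>
      (\<forall>j\<in>W. real_of_int j / 2 ^ b \<in> digit_set M \<and> \<lfloor>2 ^ a * (real_of_int j / 2 ^ b)\<rfloor> = \<lfloor>2 ^ a * x $ i\<rfloor>)"
      using digit_set_points_ge[OF ab] x by (simp add: cantor_set_def c_def)
    then obtain W :: "'n \<Rightarrow> int set" where W: "\<And>i. finite (W i)" "\<And>i. card (W i) = 2 ^ c"
      "\<And>i j. j \<in> W i \<Longrightarrow> real_of_int j / 2 ^ b \<in> digit_set M"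
      "\<And>i j. j \<in> W i \<Longrightarrow> \<lfloor>2 ^ a * (real_of_int j / 2 ^ b)\<rfloor> = \<lfloor>2 ^ a * x $ i\<rfloor>"
      by metis
    define pt where "pt j = (\<chi> i. real_of_int (j i) / 2 ^ b)" for j :: "'n \<Rightarrow> int"
    have sep: "4 * 2 powr - u < dist (pt j) (pt k)" if jk: "j \<noteq> k" for j k
    proof -
      obtain i where i: "j i \<noteq> k i" using jk by blast
      have "4 * 2 powr - u < 2 powr - real b"
      proof -
        have "real b + 3 \<le> u" using True unfolding b_def by linarith
        then have "2 powr - u \<le> 2 powr (- real b - 3)" by (intro powr_mono) auto
        also have "\<dots> = 2 powr - real b / 8" by (simp add: powr_diff)
        finally show ?thesis using powr_gt_zero[of 2 "- real b"] by linarith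
      qed
      also have "\<dots> \<le> \<bar>real_of_int (j i) - real_of_int (k i)\<bar> / 2 ^ b"
        using i by (simp add: powr_minus powr_realpow inverse_eq_divide divide_right_mono)
      also have "\<dots> = \<bar>pt j $ i - pt k $ i\<bar>" by (simp add: pt_def flip: diff_divide_distrib)
      also have "\<dots> \<le> dist (pt j) (pt k)" by (rule coordinate_dist_le)
      finally show ?thesis .
    qed
    have near: "pt j \<in> ?E" if j: "j \<in> PiE UNIV W" for j
    proof -
      have "\<bar>x $ i - pt j $ i\<bar> \<le> 2 powr - real a" for i
      proof -
        have "\<lfloor>2 ^ a * pt j $ i\<rfloor> = \<lfloor>2 ^ a * x $ i\<rfloor>" using W(4)[of "j i" i] j by (auto simp: pt_def)
        then have "\<bar>2 ^ a * x $ i - 2 ^ a * pt j $ i\<bar> \<le> 1" by linarith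
        then have "2 ^ a * \<bar>x $ i - pt j $ i\<bar> \<le> 1"
          by (metis abs_mult abs_numeral power_abs right_diff_distrib)
        then show ?thesis by (simp add: powr_minus powr_realpow field_simps)
      qed
      then have "dist x (pt j) \<le> real CARD('n) * 2 powr - real a" by (rule dist_le_coordinates)
      also have "\<dots> \<le> 2 powr - real (nat \<lceil>v\<rceil>)"
        using card_le_two_power[where 'n = 'n, of "real (nat \<lceil>v\<rceil>)"] by (simp add: a_def)
      also have "\<dots> \<le> 2 powr - v" by simp linarith
      finally have "dist x (pt j) \<le> 2 powr - v" .
      moreover have "pt j \<in> ?X" using W(3) j by (auto simp: cantor_set_def pt_def)
      ultimately show ?thesis by (simp add: rel_cball_def)
    qed
    have zero: "0 < dist (pt j) (pt k)" if "j \<noteq> k" for j k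
      using sep[OF that] powr_gt_zero[of 2 "- u"] by linarith
    then have "inj_on pt (PiE UNIV W)" by (force intro: inj_onI)
    then have "card (pt ` PiE UNIV W) = (\<Prod>i\<in>(UNIV::'n set). 2 ^ c)"
      by (simp add: card_image card_PiE W(2))
    then have card: "card (pt ` PiE UNIV W) = (2 ^ c) ^ CARD('n)" by simp
    have "finite (PiE UNIV W)" by (intro finite_PiE W(1)) simp
    then have "is_packing (2 powr - u) ?E (pt ` PiE UNIV W)"
      unfolding is_packing_def using near by (auto intro: sep)
    moreover have "2 powr real (CARD('n) * c) \<le> real (card (pt ` PiE UNIV W))"
      unfolding card by (subst powr_realpow) (simp_all add: mult.commute flip: power_mult)
    ultimately show "\<exists>A. is_packing (2 powr - u) ?E A \<and> 2 powr real (CARD('n) * c) \<le> real (card A)"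
      by blast
  qed
  then show ?thesis unfolding c_def a_def b_def .
qed


section \<open>A uniform set realising a rate function\<close>

context rate_function
begin

text \<open>All coordinates use the same free digits. As \<open>growth / d\<close> is increasing and \<open>1\<close>-Lipschitz, its
  integer part increases by \<open>0\<close> or \<open>1\<close> at each step, and a digit is freed at each increase.\<close>

definition digit_count :: "nat \<Rightarrow> int" where
  "digit_count m = \<lfloor>growth (real m) / d\<rfloor>"

definition free_digits :: "nat set" where
  "free_digits = {m. digit_count (Suc m) \<noteq> digit_count m}"

lemma digit_count_Suc:
  "digit_count (Suc m) = digit_count m + (if m \<in> free_digits then 1 else 0)"
proof -
  have "growth (real m) / d \<le> growth (real (Suc m)) / d"
    using growth_mono[of "real m" "real (Suc m)"] d_pos by (simp add: divide_right_mono)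
  moreover have "growth (real (Suc m)) / d \<le> growth (real m) / d + 1"
    using growth_lipschitz[of "real m" "real (Suc m)"] d_pos by (simp add: field_simps)
  ultimately have "digit_count m \<le> digit_count (Suc m)" "digit_count (Suc m) \<le> digit_count m + 1"
    unfolding digit_count_def by linarith+
  then show ?thesis by (auto simp: free_digits_def)
qed

lemma card_free_digits:
  "a \<le> b \<Longrightarrow> int (card (free_digits \<inter> {a..<b})) = digit_count b - digit_count a"
proof (induction b rule: dec_induct)
  case (step b)
  then show ?case using free_digits_Suc[of a b free_digits] digit_count_Suc[of b] by simp
qed simp

lemma card_free_digits_bounds:
  assumes "a \<le> b"
  shows "d * card (free_digits \<inter> {a..<b}) \<le> growth b - growth a + d"
    and "growth b - growth a - d \<le> d * card (free_digits \<inter> {a..<b})"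
proof -
  have "real (card (free_digits \<inter> {a..<b})) = real_of_int (digit_count b - digit_count a)"
    using card_free_digits[OF assms] by (metis of_int_of_nat_eq)
  then have "real (card (free_digits \<inter> {a..<b})) \<le> growth b / d - growth a / d + 1"
    "growth b / d - growth a / d - 1 \<le> real (card (free_digits \<inter> {a..<b}))"
    unfolding digit_count_def by linarith+
  from mult_left_mono[OF this(1), of d] mult_left_mono[OF this(2), of d]
  show "d * card (free_digits \<inter> {a..<b}) \<le> growth b - growth a + d"
    and "growth b - growth a - d \<le> d * card (free_digits \<inter> {a..<b})"
    using d_pos by (simp_all add: algebra_simps)
qed

lemma growth_diff_le:
  assumes "0 \<le> x" "0 \<le> y" "y \<le> x + c" "0 \<le> c"
  shows "growth y \<le> growth x + d * c"
proof (cases "x \<le> y")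
  case True
  then have "growth y \<le> growth x + d * (y - x)" using growth_lipschitz assms by simp
  also have "d * (y - x) \<le> d * c" using assms d_pos by (intro mult_left_mono) auto
  finally show ?thesis by simp
next
  case False
  moreover have "0 \<le> d * c" using assms d_pos by simp
  ultimately show ?thesis using growth_mono[of y x] assms by simp
qed

end

text \<open>The parameter \<open>dimension_type\<close> only makes the index type known to the locale.\<close>

locale euclidean_rate_function = rate_function \<phi> d for \<phi> d +
  fixes dimension_type :: "'n::finite itself"
  assumes d_eq: "d = real CARD('n)"
begin

abbreviation F :: "(real ^ 'n) set" where "F \<equiv> cantor_set free_digits"

text \<open>The counts of \<open>F\<close> at scales \<open>v \<le> u\<close> differ from \<open>growth u - growth v\<close> by a bounded amount, as \<open>growth\<close>
  is Lipschitz and all roundings of scales are bounded.\<close>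

lemma upper_beta_F:
  assumes "v \<le> u"
  shows "upper_beta F u v \<le> ereal (growth (max u 0) - growth (max v 0) + d * (d + 5))"
proof -
  let ?a = "nat \<lfloor>v\<rfloor>" and ?b = "nat \<lceil>u\<rceil> + CARD('n)"
  have ab: "?a \<le> ?b" using assms by linarith
  have "real ?b \<le> max u 0 + (d + 1)" "max v 0 \<le> real ?a + 1" by (simp_all add: d_eq, linarith+)
  then have "growth ?b \<le> growth (max u 0) + d * (d + 1)" "growth (max v 0) \<le> growth ?a + d * 1"
    by (intro growth_diff_le; use d_pos in simp)+
  then have "d * (2 + card (free_digits \<inter> {?a..<?b})) \<le> growth (max u 0) - growth (max v 0) + d * (d + 5)"
    using card_free_digits_bounds(1)[OF ab] by (simp add: algebra_simps)
  moreover have "upper_beta F u v \<le> ereal (d * (2 + card (free_digits \<inter> {?a..<?b})))"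
    using upper_beta_cantor_set[OF assms, of free_digits, where 'n = 'n]
    by (simp add: d_eq distrib_left mult.commute)
  ultimately show ?thesis using order_trans ereal_less_eq(3) by blast
qed

lemma lower_beta_F:
  assumes "v \<le> u"
  shows "ereal (growth (max u 0) - growth (max v 0) - d * (d + 6)) \<le> lower_beta F u v"
proof -
  let ?a = "nat \<lceil>v\<rceil> + CARD('n)" and ?b = "nat (\<lfloor>u\<rfloor> - 3)"
  have "max u 0 \<le> real ?b + 4" "real ?a \<le> max v 0 + (d + 1)" by (simp_all add: d_eq, linarith+)
  then have g: "growth (max u 0) \<le> growth ?b + d * 4" "growth ?a \<le> growth (max v 0) + d * (d + 1)"
    by (intro growth_diff_le; use d_pos in simp)+
  have "growth ?b - growth ?a - d \<le> d * card (free_digits \<inter> {?a..<?b})"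
  proof (cases "?a \<le> ?b")
    case True
    then show ?thesis by (rule card_free_digits_bounds(2))
  next
    case False
    then show ?thesis using growth_mono[of ?b ?a] d_pos by simp
  qed
  then have "growth (max u 0) - growth (max v 0) - d * (d + 6) \<le> d * card (free_digits \<inter> {?a..<?b})"
    using g by (simp add: algebra_simps)
  moreover have "ereal (d * card (free_digits \<inter> {?a..<?b})) \<le> lower_beta F u v"
    using lower_beta_cantor_set[OF assms, of free_digits, where 'n = 'n]
    by (simp add: d_eq distrib_left mult.commute)
  ultimately show ?thesis using order_trans ereal_less_eq(3) by blast
qed

definition error :: real where "error = d * (d + 6)"

sublocale doubling_set F d "d * log 2 (4 * d)"
  unfolding d_eq by (rule doubling_set_euclidean[OF cantor_set_nonempty])

lemma hi_le_growth:
  assumes "v \<le> u"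
  shows "hi u v \<le> growth (max u 0) - growth (max v 0) + error"
proof -
  have "d * (d + 5) \<le> error" unfolding error_def using d_pos by (intro mult_left_mono) auto
  then show ?thesis using upper_beta_F[OF assms] upper_beta_eq[OF assms] by simp
qed

lemma growth_le_lo: "v \<le> u \<Longrightarrow> growth (max u 0) - growth (max v 0) - error \<le> lo u v"
  using lower_beta_F[of v u] lower_beta_eq[of v u] by (simp add: error_def)

sublocale uniform_doubling_set F d "d * log 2 (4 * d)" "\<lambda>_. 2 * error"
proof unfold_locales
  show "((\<lambda>u. inverse u * (2 * error)) \<longlongrightarrow> 0) at_top"
    using tendsto_mult_left_zero[OF tendsto_inverse_0_at_top[OF filterlim_ident], of "2 * error"] by simp
  show "hi u v \<le> lo u v + 2 * error" if "v \<le> u" for u v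
    using hi_le_growth[OF that] growth_le_lo[OF that] by simp
qed

text \<open>The lower limit of \<open>(growth u - growth (\<theta> * u)) / u\<close> is \<open>\<phi> \<theta>\<close>: it is a lower bound for all \<open>u\<close>, and
  nearly attained along the factorials.\<close>

lemma scaled_lower_spectrum_F:
  assumes \<theta>: "\<theta> \<in> {0<..1}"
  shows "scaled_lower_spectrum \<theta> F = ereal (\<phi> \<theta>)"
proof (rule scaled_lower_spectrum_eqI[OF \<theta>])
  have vu: "\<theta> * u \<le> u" "max u 0 = u" "max (\<theta> * u) 0 = \<theta> * u" if "u > 0" for u
    using that \<theta> by simp_all
  show "growth_at_least \<theta> (\<phi> \<theta>)"
    unfolding growth_at_least_def
  proof (intro allI impI)
    fix \<epsilon> :: real assume \<epsilon>: "\<epsilon> > 0"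
    show "\<forall>\<^sub>F u in at_top. (\<phi> \<theta> - \<epsilon>) * u \<le> lo u (\<theta> * u)"
      using eventually_const_le_linear[OF \<epsilon>, of error] eventually_gt_at_top[of "0::real"]
    proof eventually_elim
      case (elim u)
      then show ?case
        using growth_gap[OF elim(2) \<theta>] growth_le_lo[OF vu(1)[OF elim(2)]] vu[OF elim(2)]
        by (simp add: algebra_simps)
    qed
  qed
  fix c assume c: "growth_at_least \<theta> c"
  show "c \<le> \<phi> \<theta>"
  proof (rule field_le_epsilon)
    fix \<epsilon> :: real assume "\<epsilon> > 0"
    then have e3: "\<epsilon> / 3 > 0" by simp
    then have "\<forall>\<^sub>F u in at_top. (c - \<epsilon> / 3) * u \<le> lo u (\<theta> * u)"
      using c unfolding growth_at_least_def by blast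
    then have "\<forall>\<^sub>F u in at_top. (c - \<epsilon> / 3) * u \<le> lo u (\<theta> * u) \<and> error \<le> \<epsilon> / 3 * u"
      using eventually_const_le_linear[OF e3, of error] by eventually_elim simp
    then obtain N where N: "\<And>u. u \<ge> N \<Longrightarrow> (c - \<epsilon> / 3) * u \<le> lo u (\<theta> * u) \<and> error \<le> \<epsilon> / 3 * u"
      unfolding eventually_at_top_linorder by blast
    \<comment> \<open>The error at \<open>fact k\<close> is \<open>2 * d * fact (k - 1) = 2 * d / k * fact k\<close>, which \<open>k \<ge> 6 * d / \<epsilon>\<close> makes small.\<close>
    obtain k :: nat where k: "max N (max 1 (6 * d / \<epsilon>)) \<le> real k" using real_arch_simple by blast
    let ?u = "fact k :: real"
    have k1: "1 \<le> k" using k by simp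
    have u: "?u = real k * fact (k - 1)" using k1 by (simp add: fact_reduce)
    have "real k \<le> ?u" using fact_ge_self[of k] by (metis of_nat_fact of_nat_le_iff)
    then have big: "N \<le> ?u" using k by simp
    have "2 * d * fact (k - 1) \<le> \<epsilon> / 3 * ?u"
    proof -
      have "2 * d \<le> \<epsilon> / 3 * real k" using k \<open>\<epsilon> > 0\<close> by (simp add: field_simps)
      then have "2 * d * fact (k - 1) \<le> \<epsilon> / 3 * real k * fact (k - 1)" by (intro mult_right_mono) auto
      then show ?thesis by (simp add: u)
    qed
    moreover have "growth ?u - growth (\<theta> * ?u) \<le> \<phi> \<theta> * ?u + 2 * d * fact (k - 1)"
      using growth_gap_fact[OF k1 \<theta>] .
    moreover have "lo ?u (\<theta> * ?u) \<le> growth ?u - growth (\<theta> * ?u) + error"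
      using lo_le_hi[OF vu(1), of ?u] hi_le_growth[OF vu(1), of ?u] vu[of ?u] by simp
    ultimately have "(c - \<epsilon> / 3) * ?u \<le> \<phi> \<theta> * ?u + \<epsilon> / 3 * ?u + \<epsilon> / 3 * ?u"
      using N[OF big] by linarith
    then have "c * ?u \<le> (\<phi> \<theta> + \<epsilon>) * ?u" by (simp add: algebra_simps)
    then show "c \<le> \<phi> \<theta> + \<epsilon>" by (simp add: mult_le_cancel_right)
  qed
qed

end

theorem theoremC:
  fixes \<phi> :: "real \<Rightarrow> real"
  assumes "\<And>\<theta>. \<theta> \<in> {0<..1} \<Longrightarrow> \<phi> \<theta> \<in> {0..real CARD('n::finite)}"
  shows "(\<exists>F :: (real ^ 'n) set. F \<noteq> {} \<and> uniform_set F \<and>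
            (\<forall>\<theta>\<in>{0<..1}. scaled_lower_spectrum \<theta> F = ereal (\<phi> \<theta>)))
         \<longleftrightarrow>
         (real CARD('n))-lipschitz_on {0<..1} \<phi> \<and>
         (\<forall>\<kappa>\<in>{0<..1}. \<forall>\<theta>\<in>{0<..1}. \<phi> \<theta> \<le> \<phi> (\<kappa> * \<theta>) - \<theta> * \<phi> \<kappa>)"
proof
  assume "\<exists>F :: (real ^ 'n) set. F \<noteq> {} \<and> uniform_set F \<and>
            (\<forall>\<theta>\<in>{0<..1}. scaled_lower_spectrum \<theta> F = ereal (\<phi> \<theta>))"
  then obtain F :: "(real ^ 'n) set" and \<eta> where F: "F \<noteq> {}" "eta_uniform \<eta> F"
    and spec: "\<And>\<theta>. \<theta> \<in> {0<..1} \<Longrightarrow> scaled_lower_spectrum \<theta> F = ereal (\<phi> \<theta>)"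
    unfolding uniform_set_def by blast
  interpret uniform_doubling_set F "real CARD('n)" "real CARD('n) * log 2 (4 * real CARD('n))" \<eta>
    using doubling_set.uniform_doubling_set_iff[OF doubling_set_euclidean[OF F(1)]] F(2) by blast
  have "0 \<le> \<phi> \<theta>" if "\<theta> \<in> {0<..1}" for \<theta> using assms[OF that] by simp
  then show "(real CARD('n))-lipschitz_on {0<..1} \<phi> \<and>
      (\<forall>\<kappa>\<in>{0<..1}. \<forall>\<theta>\<in>{0<..1}. \<phi> \<theta> \<le> \<phi> (\<kappa> * \<theta>) - \<theta> * \<phi> \<kappa>)"
    using scaled_lower_spectrum_necessary[of \<phi>] spec by simp
next
  assume "(real CARD('n))-lipschitz_on {0<..1} \<phi> \<and>
      (\<forall>\<kappa>\<in>{0<..1}. \<forall>\<theta>\<in>{0<..1}. \<phi> \<theta> \<le> \<phi> (\<kappa> * \<theta>) - \<theta> * \<phi> \<kappa>)"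
  then interpret euclidean_rate_function \<phi> "real CARD('n)" "TYPE('n)"
    using assms by unfold_locales auto
  have "eta_uniform (\<lambda>_. 2 * error) F"
    using uniform_doubling_set_iff uniform_doubling_set_axioms by blast
  then have "uniform_set F" unfolding uniform_set_def by blast
  then show "\<exists>F :: (real ^ 'n) set. F \<noteq> {} \<and> uniform_set F \<and>
            (\<forall>\<theta>\<in>{0<..1}. scaled_lower_spectrum \<theta> F = ereal (\<phi> \<theta>))"
    using nonempty scaled_lower_spectrum_F by blast
qed

end
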